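(* Let $\mathcal{A}\subseteq\mathcal{B}(\mathcal{H})$ be a von Neumann algebra, $T:\mathcal{A}\to\mathcal{A}$ a Markov operator, and $p\in\mathcal{A}$ an orthogonal projection. Then the following are equivalent: (i) $p\leq \mathbbm{1}-p_{Tr}$, where $p_{Tr}$ is the maximal transient projection of $T$ (i.e. $p$ is recurrent). (ii) For all $a\in\mathcal{A}_+$ with $T(a)\leq a$ we have $pT(a)p=pap$.
   Context: A Markov operator is a normal completely positive unital linear map on $\mathcal{A}$ ($\mathbbm{1}\in\mathcal{A}$). An element $x\in\mathcal{A}_+$ is $T$-summable if $\sum_{n\ge0}T^n(x)$ converges strongly to an element of $\mathcal{A}_+$. An orthogonal projection $q\in\mathcal{A}$ is transient if $q\le\bigvee_{j\in J}p_j$ for some family of $T$-summable orthogonal projections $p_j\in\mathcal{A}$. The maximal transient projection $p_{Tr}$ is the supremum of all transient projections. *)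

theory Defs
  imports "HOL-Analysis.Analysis"
begin

class chilbert = ab_group_add +
  fixes scaleC :: "complex \<Rightarrow> 'a \<Rightarrow> 'a"
    and cinner :: "'a \<Rightarrow> 'a \<Rightarrow> complex"
  assumes scaleC_add_right: "scaleC c (x + y) = scaleC c x + scaleC c y"
    and scaleC_add_left: "scaleC (c + d) x = scaleC c x + scaleC d x"
    and scaleC_scaleC: "scaleC c (scaleC d x) = scaleC (c * d) x"
    and scaleC_one: "scaleC 1 x = x"
    and cinner_add_right: "cinner x (y + z) = cinner x y + cinner x z"
    and cinner_scaleC_right: "cinner x (scaleC c y) = c * cinner x y"
    and cinner_commute: "cinner y x = cnj (cinner x y)"
    and cinner_nonneg: "0 \<le> Re (cinner x x)"
    and cinner_eq_zero: "cinner x x = 0 \<Longrightarrow> x = 0"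
    and complete: "(\<forall>e>0. \<exists>N. \<forall>m\<ge>N. \<forall>n\<ge>N. sqrt (Re (cinner (X m - X n) (X m - X n))) < e)
       \<Longrightarrow> \<exists>L. (\<lambda>n. sqrt (Re (cinner (X n - L) (X n - L)))) \<longlonglongrightarrow> 0"

definition cnorm :: "'h::chilbert \<Rightarrow> real" where
  "cnorm x = sqrt (Re (cinner x x))"

definition bounded_op :: "('h::chilbert \<Rightarrow> 'h) \<Rightarrow> bool" where
  "bounded_op A \<longleftrightarrow> (\<forall>x y. A (x + y) = A x + A y) \<and> (\<forall>c x. A (scaleC c x) = scaleC c (A x))
     \<and> (\<exists>K. \<forall>x. cnorm (A x) \<le> K * cnorm x)"

definition adj :: "('h::chilbert \<Rightarrow> 'h) \<Rightarrow> ('h \<Rightarrow> 'h)" where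
  "adj A = (THE B. \<forall>x y. cinner (A x) y = cinner x (B y))"

definition pos_op :: "('h::chilbert \<Rightarrow> 'h) \<Rightarrow> bool" where
  "pos_op A \<longleftrightarrow> bounded_op A \<and> (\<forall>x. Im (cinner x (A x)) = 0 \<and> 0 \<le> Re (cinner x (A x)))"

definition op_le :: "('h::chilbert \<Rightarrow> 'h) \<Rightarrow> ('h \<Rightarrow> 'h) \<Rightarrow> bool" where
  "op_le A B \<longleftrightarrow> bounded_op A \<and> bounded_op B \<and> pos_op (\<lambda>x. B x - A x)"

definition orth_proj :: "('h::chilbert \<Rightarrow> 'h) \<Rightarrow> bool" where
  "orth_proj P \<longleftrightarrow> bounded_op P \<and> P \<circ> P = P \<and> adj P = P"

definition commutant :: "('h::chilbert \<Rightarrow> 'h) set \<Rightarrow> ('h \<Rightarrow> 'h) set" where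
  "commutant S = {B. bounded_op B \<and> (\<forall>A\<in>S. A \<circ> B = B \<circ> A)}"

text \<open>von Neumann algebra: self-adjoint set of bounded operators equal to its
  bicommutant (equivalently a unital weakly closed *-subalgebra of B(H)).\<close>
definition von_neumann_algebra :: "('h::chilbert \<Rightarrow> 'h) set \<Rightarrow> bool" where
  "von_neumann_algebra M \<longleftrightarrow> M \<subseteq> {A. bounded_op A} \<and> id \<in> M \<and> (\<forall>A\<in>M. adj A \<in> M)
     \<and> commutant (commutant M) = M"

definition matrix_pos :: "nat \<Rightarrow> (nat \<Rightarrow> nat \<Rightarrow> ('h::chilbert \<Rightarrow> 'h)) \<Rightarrow> bool" where
  "matrix_pos n a \<longleftrightarrow> (\<forall>i<n. \<forall>j<n. bounded_op (a i j)) \<and>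
     (\<forall>\<xi> :: nat \<Rightarrow> 'h. let s = (\<Sum>i<n. \<Sum>j<n. cinner (\<xi> i) (a i j (\<xi> j))) in Im s = 0 \<and> 0 \<le> Re s)"

definition completely_positive ::
  "('h::chilbert \<Rightarrow> 'h) set \<Rightarrow> (('h \<Rightarrow> 'h) \<Rightarrow> ('h \<Rightarrow> 'h)) \<Rightarrow> bool" where
  "completely_positive M T \<longleftrightarrow> (\<forall>n a. (\<forall>i<n. \<forall>j<n. a i j \<in> M) \<and> matrix_pos n a
       \<longrightarrow> matrix_pos n (\<lambda>i j. T (a i j)))"

definition is_lub_in :: "('h::chilbert \<Rightarrow> 'h) set \<Rightarrow> ('h \<Rightarrow> 'h) set \<Rightarrow> ('h \<Rightarrow> 'h) \<Rightarrow> bool" where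
  "is_lub_in M D s \<longleftrightarrow> s \<in> M \<and> (\<forall>d\<in>D. op_le d s) \<and> (\<forall>u\<in>M. (\<forall>d\<in>D. op_le d u) \<longrightarrow> op_le s u)"

definition normal_map :: "('h::chilbert \<Rightarrow> 'h) set \<Rightarrow> (('h \<Rightarrow> 'h) \<Rightarrow> ('h \<Rightarrow> 'h)) \<Rightarrow> bool" where
  "normal_map M T \<longleftrightarrow> (\<forall>D s. D \<noteq> {} \<and> D \<subseteq> M \<and> (\<forall>d\<in>D. pos_op d)
       \<and> (\<forall>x\<in>D. \<forall>y\<in>D. \<exists>z\<in>D. op_le x z \<and> op_le y z) \<and> is_lub_in M D s
       \<longrightarrow> is_lub_in M (T ` D) (T s))"

definition markov_operator :: "('h::chilbert \<Rightarrow> 'h) set \<Rightarrow> (('h \<Rightarrow> 'h) \<Rightarrow> ('h \<Rightarrow> 'h)) \<Rightarrow> bool" where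
  "markov_operator M T \<longleftrightarrow> (\<forall>A\<in>M. T A \<in> M)
     \<and> (\<forall>A\<in>M. \<forall>B\<in>M. T (\<lambda>x. A x + B x) = (\<lambda>x. T A x + T B x))
     \<and> (\<forall>A\<in>M. \<forall>c. T (\<lambda>x. scaleC c (A x)) = (\<lambda>x. scaleC c (T A x)))
     \<and> T id = id \<and> completely_positive M T \<and> normal_map M T"

definition T_summable :: "('h::chilbert \<Rightarrow> 'h) set \<Rightarrow> (('h \<Rightarrow> 'h) \<Rightarrow> ('h \<Rightarrow> 'h)) \<Rightarrow> ('h \<Rightarrow> 'h) \<Rightarrow> bool" where
  "T_summable M T x \<longleftrightarrow> x \<in> M \<and> pos_op x \<and>
     (\<exists>y\<in>M. pos_op y \<and> (\<forall>\<xi>. (\<lambda>N. cnorm ((\<Sum>n<N. (T ^^ n) x \<xi>) - y \<xi>)) \<longlonglongrightarrow> 0))"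

definition is_proj_sup :: "('h::chilbert \<Rightarrow> 'h) set \<Rightarrow> ('h \<Rightarrow> 'h) set \<Rightarrow> ('h \<Rightarrow> 'h) \<Rightarrow> bool" where
  "is_proj_sup M S s \<longleftrightarrow> orth_proj s \<and> s \<in> M \<and> (\<forall>p\<in>S. op_le p s)
     \<and> (\<forall>r. orth_proj r \<and> r \<in> M \<and> (\<forall>p\<in>S. op_le p r) \<longrightarrow> op_le s r)"

definition transient_proj :: "('h::chilbert \<Rightarrow> 'h) set \<Rightarrow> (('h \<Rightarrow> 'h) \<Rightarrow> ('h \<Rightarrow> 'h)) \<Rightarrow> ('h \<Rightarrow> 'h) \<Rightarrow> bool" where
  "transient_proj M T q \<longleftrightarrow> orth_proj q \<and> q \<in> M \<and>
     (\<exists>S s. (\<forall>p\<in>S. orth_proj p \<and> T_summable M T p) \<and> is_proj_sup M S s \<and> op_le q s)"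

definition max_transient_proj :: "('h::chilbert \<Rightarrow> 'h) set \<Rightarrow> (('h \<Rightarrow> 'h) \<Rightarrow> ('h \<Rightarrow> 'h)) \<Rightarrow> ('h \<Rightarrow> 'h)" where
  "max_transient_proj M T = (THE s. is_proj_sup M {q. transient_proj M T q} s)"

end

theory Submission
  imports Defs
begin

text \<open>If \<open>q\<close> is a summable projection, its potential \<open>y = \<Sum>\<^sub>n T\<^sup>n q\<close> satisfies \<open>T y = y - q\<close> by normality,
  so (ii) applied to \<open>y\<close> gives \<open>p q p = 0\<close>, that is \<open>q \<le> 1 - p\<close>. Conversely, for \<open>T a \<le> a\<close> put
  \<open>x = a - T a\<close>; its partial sums \<open>\<Sum>\<^sub>n T\<^sup>n x\<close> telescope and are bounded by \<open>a\<close>. The spectral projection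
  \<open>q\<close> of \<open>x\<close> for \<open>(e, \<infinity>)\<close> satisfies \<open>e q \<le> x\<close>, so it is summable, hence orthogonal to a recurrent
  \<open>p\<close>, and therefore \<open>p x p \<le> e p\<close> for every \<open>e > 0\<close>. The spectral projection only needs the square
  root \<open>\<bar>x - e\<bar>\<close>, obtained as a strong limit of polynomials with nonnegative coefficients.\<close>

section \<open>Hilbert space geometry\<close>

text \<open>Normality speaks of suprema, summability of strong limits. The two meet on bounded
  increasing sequences, whose strong limit is their supremum; \<open>T y\<close> is therefore found
  by comparing suprema, not by continuity. The cut at \<open>e\<close> cannot be avoided: the
  support projection of \<open>x\<close> need not be summable, whereas \<open>e q \<le> x\<close>
  bounds the partial sums of \<open>q\<close> by those of \<open>x\<close> divided by
  \<open>e\<close>. Hence the limit \<open>e \<rightarrow> 0\<close> at the end. The order between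
  projections is handled through kernels: a supremum corresponds to an intersection of kernels, and
  recurrence of \<open>p\<close> says that every vector \<open>w = p v\<close> is killed by
  \<open>p_Tr\<close>. The identity in (ii) can then be tested on such single vectors. A projection
  is shown to lie in \<open>M\<close> by checking that its range is invariant under the commutant.
  This is why the square root must commute with everything that commutes with the operator under
  it.\<close>

lemma cinner_zero_right [simp]: "cinner x (0::'h::chilbert) = 0"
  using cinner_add_right[of x 0 0] by simp

lemma cinner_zero_left [simp]: "cinner (0::'h::chilbert) x = 0"
  using cinner_commute[of 0 x] by simp

lemma cinner_add_left: "cinner (x + y) (z::'h::chilbert) = cinner x z + cinner y z"
  using cinner_commute[of _ z] by (simp add: cinner_add_right)

lemma cinner_minus_right: "cinner x (- y::'h::chilbert) = - cinner x y"
  using cinner_add_right[of x y "-y"] by (simp add: eq_neg_iff_add_eq_0 add.commute)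

lemma cinner_minus_left: "cinner (- x) (y::'h::chilbert) = - cinner x y"
  using cinner_commute[of _ y] by (simp add: cinner_minus_right)

lemma cinner_diff_right: "cinner x (y - z::'h::chilbert) = cinner x y - cinner x z"
  using cinner_add_right[of x y "-z"] by (simp add: cinner_minus_right)

lemma cinner_diff_left: "cinner (x - y) (z::'h::chilbert) = cinner x z - cinner y z"
  using cinner_add_left[of x "-y" z] by (simp add: cinner_minus_left)

lemma cinner_scaleC_left: "cinner (scaleC c x) (y::'h::chilbert) = cnj c * cinner x y"
  using cinner_commute[of _ y] by (simp add: cinner_scaleC_right)

lemma cinner_sum_right: "cinner x (sum f A) = (\<Sum>i\<in>A. cinner x (f i :: 'h::chilbert))"
  by (induction A rule: infinite_finite_induct) (auto simp: cinner_add_right)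

lemmas cinner_simps = cinner_add_left cinner_add_right cinner_diff_left cinner_diff_right
  cinner_scaleC_left cinner_scaleC_right cinner_minus_left cinner_minus_right

lemma cinner_ext: "(\<And>z. cinner z x = cinner z (y::'h::chilbert)) \<Longrightarrow> x = y"
  using cinner_eq_zero[of "x - y"] by (simp add: cinner_diff_right)

lemma scaleC_zero_left [simp]: "scaleC 0 (x::'h::chilbert) = 0"
  by (rule cinner_ext) (simp add: cinner_simps)

lemma scaleC_zero_right [simp]: "scaleC c (0::'h::chilbert) = 0"
  by (rule cinner_ext) (simp add: cinner_simps)

lemma scaleC_minus1: "scaleC (-1) (x::'h::chilbert) = - x"
  by (rule cinner_ext) (simp add: cinner_simps)

lemma scaleC_diff_right: "scaleC c (x - y::'h::chilbert) = scaleC c x - scaleC c y"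
  by (rule cinner_ext) (simp add: cinner_simps algebra_simps)

lemma Im_cinner_self [simp]: "Im (cinner x (x::'h::chilbert)) = 0"
  using cinner_commute[of x x] by (metis cnj.simps(2) equal_neg_zero)

lemma cnorm_ge_0 [simp]: "0 \<le> cnorm (x::'h::chilbert)"
  by (simp add: cnorm_def cinner_nonneg)

lemma cnorm_sq: "(cnorm (x::'h::chilbert))\<^sup>2 = Re (cinner x x)"
  by (simp add: cnorm_def cinner_nonneg)

lemma cinner_self: "cinner x (x::'h::chilbert) = of_real ((cnorm x)\<^sup>2)"
  by (simp add: complex_eq_iff cnorm_sq)

lemma cnorm_eq_0 [simp]: "cnorm (x::'h::chilbert) = 0 \<longleftrightarrow> x = 0"
  using cinner_eq_zero[of x] by (auto simp: cinner_self) (simp add: cnorm_def)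

lemma cnorm_zero [simp]: "cnorm (0::'h::chilbert) = 0"
  by simp

lemma mult_self_le_cancel: "(a::real) * a \<le> a * b \<Longrightarrow> 0 \<le> b \<Longrightarrow> 0 \<le> a \<Longrightarrow> a \<le> b"
  by (cases "a = 0") auto

lemma cnorm_scaleC: "cnorm (scaleC c (x::'h::chilbert)) = cmod c * cnorm x"
proof -
  have "cnj c * (c * cinner x x) = of_real ((cmod c)\<^sup>2 * (cnorm x)\<^sup>2)"
    by (simp only: cinner_self complex_norm_square of_real_mult) (simp add: mult_ac)
  then have "(cnorm (scaleC c x))\<^sup>2 = (cmod c * cnorm x)\<^sup>2"
    unfolding cnorm_sq[of "scaleC c x"] cinner_scaleC_left cinner_scaleC_right
    by (simp only: power_mult_distrib Re_complex_of_real mult.left_commute)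
  then show ?thesis by (simp add: power2_eq_iff_nonneg)
qed

lemma cnorm_minus: "cnorm (- x) = cnorm (x::'h::chilbert)"
  by (simp add: cnorm_def cinner_simps)

lemma cnorm_minus_commute: "cnorm (x - y) = cnorm (y - (x::'h::chilbert))"
  using cnorm_minus[of "x - y"] by simp

definition lin :: "('h::chilbert \<Rightarrow> 'h) \<Rightarrow> bool" where
  "lin A \<longleftrightarrow> (\<forall>x y. A (x + y) = A x + A y) \<and> (\<forall>c x. A (scaleC c x) = scaleC c (A x))"

lemma lin_add: "lin A \<Longrightarrow> A (x + y) = A x + A y"
  and lin_scaleC: "lin A \<Longrightarrow> A (scaleC c x) = scaleC c (A x)"
  by (auto simp: lin_def)

lemma lin_minus: "lin A \<Longrightarrow> A (- x) = - A x"
  using lin_scaleC[of A "-1" x] by (simp add: scaleC_minus1)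

lemma lin_diff: "lin A \<Longrightarrow> A (x - y) = A x - A y"
  using lin_add[of A x "-y"] by (simp add: lin_minus)

lemma lin_0: "lin A \<Longrightarrow> A 0 = 0"
  using lin_diff[of A 0 0] by simp

lemmas lin_simps = lin_add lin_scaleC lin_minus lin_diff lin_0

lemma bounded_op_lin: "bounded_op A \<Longrightarrow> lin A"
  by (simp add: bounded_op_def lin_def)

lemma bounded_op_iff: "bounded_op A \<longleftrightarrow> lin A \<and> (\<exists>K. \<forall>x. cnorm (A x) \<le> K * cnorm x)"
  by (simp add: bounded_op_def lin_def)

lemma bounded_op_bound:
  assumes "bounded_op A"
  obtains K where "K > 0" "\<And>x. cnorm (A x) \<le> K * cnorm x"
proof -
  obtain K where K: "\<And>x. cnorm (A x) \<le> K * cnorm x"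
    using assms by (auto simp: bounded_op_def)
  have "cnorm (A x) \<le> max K 1 * cnorm x" for x
    using K[of x] mult_right_mono[of K "max K 1" "cnorm x"] by simp
  then show thesis using that[of "max K 1"] by simp
qed

text \<open>Polarisation: the test vectors \<open>x + y\<close> and \<open>x + scaleC \<i> y\<close>
  give the imaginary and the real part of the symmetry.\<close>

lemma real_form_sesqui:
  assumes A: "lin A" and re: "\<And>x. Im (cinner x (A x)) = 0"
  shows "cinner (A x) y = cinner x (A y)"
proof -
  have "Im (cinner (x + y) (A (x + y))) = 0" "Im (cinner (x + scaleC \<i> y) (A (x + scaleC \<i> y))) = 0"
    by (rule re)+
  then have "Im (cinner x (A y)) + Im (cinner y (A x)) = 0" "Re (cinner x (A y)) - Re (cinner y (A x)) = 0"
    using re[of x] re[of y] by (auto simp: lin_simps[OF A] cinner_simps)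
  then have "cinner x (A y) = cnj (cinner y (A x))"
    by (simp add: complex_eq_iff)
  then show ?thesis using cinner_commute[of "A x" y] by simp
qed

text \<open>Stated for semidefinite forms, so that it serves the inner product and also shows that a
  positive operator kills every vector at which its form vanishes.\<close>

lemma positive_form_Cauchy_Schwarz:
  assumes A: "lin A" and pos: "\<And>x. Im (cinner x (A x)) = 0" "\<And>x. 0 \<le> Re (cinner x (A x))"
  shows "(cmod (cinner x (A y)))\<^sup>2 \<le> Re (cinner x (A x)) * Re (cinner y (A y))"
proof -
  define z where "z = cinner x (A y)"
  define a where "a = Re (cinner x (A x))"
  define b where "b = Re (cinner y (A y))"
  have z': "cinner y (A x) = cnj z"
    using cinner_commute[of y "A x"] real_form_sesqui[OF A pos(1), of x y] by (simp add: z_def)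
  have q: "0 \<le> a - 2 * t * (cmod z)\<^sup>2 + t\<^sup>2 * (cmod z)\<^sup>2 * b" for t :: real
  proof -
    \<comment> \<open>The factor \<open>cnj z\<close> makes the cross terms real, so the form
      becomes a real quadratic polynomial in \<open>t\<close>.\<close>
    define w where "w = scaleC (- of_real t * cnj z) y"
    have "0 \<le> Re (cinner (x + w) (A (x + w)))" by (rule pos(2))
    also have "\<dots> = a - 2 * t * (cmod z)\<^sup>2 + t\<^sup>2 * (cmod z)\<^sup>2 * b"
    proof -
      have "cinner y (A y) = of_real b" by (simp add: complex_eq_iff b_def pos(1))
      then show ?thesis
        unfolding w_def cmod_power2
        by (simp add: lin_simps[OF A] cinner_simps z' z_def[symmetric] a_def[symmetric])
           (simp add: algebra_simps power2_eq_square)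
    qed
    finally show ?thesis .
  qed
  have "(cmod z)\<^sup>2 \<le> a * b"
  proof (cases "b = 0")
    case True
    have "(cmod z)\<^sup>2 = 0"
    proof (rule ccontr)
      assume "(cmod z)\<^sup>2 \<noteq> 0"
      then have z: "z \<noteq> 0" by auto
      \<comment> \<open>For \<open>b = 0\<close> the polynomial is affine in \<open>t\<close>; at
        this point its value is -1.\<close>
      show False using q[of "(a + 1) / (2 * (cmod z)\<^sup>2)"] True z
        by (simp add: field_simps)
    qed
    then show ?thesis using True by simp
  next
    case False
    then have b: "b > 0" using pos(2)[of y] by (simp add: b_def)
    \<comment> \<open>The minimum of the polynomial is at \<open>t = 1 / b\<close>.\<close>
    have "0 \<le> a - (cmod z)\<^sup>2 / b"
      using q[of "1 / b"] b by (simp add: power2_eq_square field_simps)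
    then show ?thesis using b by (simp add: field_simps)
  qed
  then show ?thesis by (simp add: z_def a_def b_def)
qed

lemma cinner_Cauchy_Schwarz: "cmod (cinner x (y::'h::chilbert)) \<le> cnorm x * cnorm y"
proof -
  have "(cmod (cinner x y))\<^sup>2 \<le> (cnorm x * cnorm y)\<^sup>2"
    using positive_form_Cauchy_Schwarz[of "\<lambda>x. x" x y]
    by (simp add: lin_def cinner_nonneg power_mult_distrib cnorm_sq)
  then show ?thesis by (rule power2_le_imp_le) simp
qed

lemma cnorm_triangle: "cnorm (x + y) \<le> cnorm x + cnorm (y::'h::chilbert)"
proof -
  have "Re (cinner x y) \<le> cnorm x * cnorm y" 
    using cinner_Cauchy_Schwarz[of x y] complex_Re_le_cmod order_trans by blast
  moreover have "Re (cinner y x) = Re (cinner x y)" using cinner_commute[of y x] by simp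
  ultimately have "(cnorm (x + y))\<^sup>2 \<le> (cnorm x + cnorm y)\<^sup>2"
    by (simp add: power2_sum cnorm_sq cinner_simps)
  then show ?thesis by (rule power2_le_imp_le) simp
qed

text \<open>The class \<open>chilbert\<close> carries no topology; limits are expressed through the
  real sequence of distances.\<close>

definition clim :: "(nat \<Rightarrow> 'h::chilbert) \<Rightarrow> 'h \<Rightarrow> bool" where
  "clim X L \<longleftrightarrow> (\<lambda>n. cnorm (X n - L)) \<longlonglongrightarrow> 0"

lemma clim_dominated:
  assumes "clim X L" "\<And>n. cnorm (Y n - M) \<le> K * cnorm (X n - L)"
  shows "clim Y M"
proof -
  have "(\<lambda>n. K * cnorm (X n - L)) \<longlonglongrightarrow> 0"
    using tendsto_mult_right_zero[OF assms(1)[unfolded clim_def]] .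
  then show ?thesis unfolding clim_def
    by (rule Lim_null_comparison[rotated]) (simp add: assms(2))
qed

lemma clim_add: "clim X a \<Longrightarrow> clim Y b \<Longrightarrow> clim (\<lambda>n. X n + Y n) (a + b)"
proof -
  assume "clim X a" "clim Y b"
  then have lim: "(\<lambda>n. cnorm (X n - a) + cnorm (Y n - b)) \<longlonglongrightarrow> 0"
    unfolding clim_def using tendsto_add by fastforce
  have le: "cnorm (X n + Y n - (a + b)) \<le> cnorm (X n - a) + cnorm (Y n - b)" for n
    using cnorm_triangle[of "X n - a" "Y n - b"] by (simp add: algebra_simps)
  show ?thesis unfolding clim_def
    by (rule Lim_null_comparison[OF _ lim]) (simp add: le)
qed

lemma clim_bounded_op:
  assumes A: "bounded_op A" and X: "clim X a"
  shows "clim (\<lambda>n. A (X n)) (A a)"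
proof -
  obtain K where "\<And>x. cnorm (A x) \<le> K * cnorm x" using bounded_op_bound[OF A] by blast
  then show ?thesis
    by (intro clim_dominated[OF X, where K = K]) (simp flip: lin_diff[OF bounded_op_lin[OF A]])
qed

lemma clim_scaleC: "clim X a \<Longrightarrow> clim (\<lambda>n. scaleC c (X n)) (scaleC c a)"
  by (rule clim_dominated[where K = "cmod c"]) (auto simp flip: scaleC_diff_right simp: cnorm_scaleC)

lemma clim_const: "clim (\<lambda>n. a) a"
  by (simp add: clim_def cnorm_def)

lemma clim_diff: "clim X a \<Longrightarrow> clim Y b \<Longrightarrow> clim (\<lambda>n. X n - Y n) (a - b)"
  using clim_add[of X a "\<lambda>n. scaleC (-1) (Y n)" "scaleC (-1) b"] clim_scaleC[of Y b "-1"]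
  by (simp add: scaleC_minus1)

lemma clim_unique: assumes "clim X a" "clim X b" shows "a = b"
proof -
  have "(\<lambda>n. cnorm (b - a)) \<longlonglongrightarrow> 0"
    using clim_diff[OF assms] by (simp add: clim_def)
  then have "cnorm (b - a) = 0" by (simp add: LIMSEQ_const_iff)
  then show ?thesis by simp
qed

lemma clim_Suc: "clim X a \<Longrightarrow> clim (\<lambda>n. X (Suc n)) a"
  unfolding clim_def by (rule LIMSEQ_Suc)

lemma clim_cinner: assumes "clim X a" shows "(\<lambda>n. cinner y (X n)) \<longlonglongrightarrow> cinner y a"
proof -
  have "(\<lambda>n. cinner y (X n) - cinner y a) \<longlonglongrightarrow> 0"
  proof (rule Lim_null_comparison)
    show "\<forall>\<^sub>F n in sequentially. norm (cinner y (X n) - cinner y a) \<le> cnorm y * cnorm (X n - a)"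
      using cinner_Cauchy_Schwarz[of y "X _ - a"] by (simp add: cinner_diff_right)
    show "(\<lambda>n. cnorm y * cnorm (X n - a)) \<longlonglongrightarrow> 0"
      using assms unfolding clim_def by (rule tendsto_mult_right_zero)
  qed
  then show ?thesis by (simp add: LIM_zero_iff)
qed

lemma clim_cnorm: assumes "clim X a" shows "(\<lambda>n. cnorm (X n)) \<longlonglongrightarrow> cnorm a"
proof -
  have "(\<lambda>n. cnorm (X n) - cnorm a) \<longlonglongrightarrow> 0"
  proof (rule Lim_null_comparison)
    have "\<bar>cnorm x - cnorm a\<bar> \<le> cnorm (x - a)" for x
      using cnorm_triangle[of "x - a" a] cnorm_triangle[of "a - x" x] cnorm_minus_commute[of a x] by simp
    then show "\<forall>\<^sub>F n in sequentially. norm (cnorm (X n) - cnorm a) \<le> cnorm (X n - a)"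
      by simp
  qed (use assms in \<open>simp add: clim_def\<close>)
  then show ?thesis by (simp add: LIM_zero_iff)
qed

lemma clim_ex:
  assumes "\<And>e. e > 0 \<Longrightarrow> \<exists>N. \<forall>m\<ge>N. \<forall>n\<ge>N. cnorm (X m - X n) < e"
  shows "\<exists>L. clim X L"
  using complete[of X] assms unfolding clim_def cnorm_def by blast

section \<open>Closed subspaces, orthogonal decomposition and adjoints\<close>

definition closed_csubspace :: "'h::chilbert set \<Rightarrow> bool" where
  "closed_csubspace K \<longleftrightarrow> 0 \<in> K \<and> (\<forall>x\<in>K. \<forall>y\<in>K. x + y \<in> K) \<and> (\<forall>c. \<forall>x\<in>K. scaleC c x \<in> K)
     \<and> (\<forall>X L. (\<forall>n. X n \<in> K) \<and> clim X L \<longrightarrow> L \<in> K)"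

lemma closed_csubspace_diff: "closed_csubspace K \<Longrightarrow> x \<in> K \<Longrightarrow> y \<in> K \<Longrightarrow> x - y \<in> K"
  unfolding closed_csubspace_def
  by (metis diff_conv_add_uminus scaleC_minus1)

lemma parallelogram:
  "Re (cinner (x + y) (x + y)) + Re (cinner (x - y) (x - y)) = 2 * Re (cinner x x) + 2 * Re (cinner y (y::'h::chilbert))"
  by (simp add: cinner_simps)

text \<open>A minimising sequence in \<open>K\<close> is Cauchy by the parallelogram law, and
  varying its limit along \<open>K\<close> gives orthogonality.\<close>

lemma projection_theorem:
  fixes x :: "'h::chilbert"
  assumes K: "closed_csubspace K"
  shows "\<exists>L\<in>K. \<forall>k\<in>K. cinner k (x - L) = 0"
proof -
  define N where "N = (\<lambda>z::'h. Re (cinner z z))"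
  define d where "d = (INF k\<in>K. N (x - k))"
  have N0: "N z \<ge> 0" for z by (simp add: N_def cinner_nonneg)
  have bdd: "bdd_below ((\<lambda>k. N (x - k)) ` K)" using N0 by (auto intro!: bdd_belowI)
  have ne: "K \<noteq> {}" using K by (auto simp: closed_csubspace_def)
  have lower: "d \<le> N (x - k)" if "k \<in> K" for k
    unfolding d_def using cINF_lower[OF bdd that] .
  have "\<exists>k\<in>K. N (x - k) < d + 1 / real (Suc n)" for n
  proof (rule ccontr)
    assume "\<not> ?thesis"
    then have "d + 1 / real (Suc n) \<le> d" unfolding d_def by (intro cINF_greatest[OF ne]) auto
    then show False by simp
  qed
  then obtain k where kK: "\<And>n. k n \<in> K" and kd: "\<And>n. N (x - k n) < d + 1 / real (Suc n)"
    by metis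
  have cau: "N (k m - k n) \<le> 2 * (1 / real (Suc m)) + 2 * (1 / real (Suc n))" for m n
  proof -
    \<comment> \<open>The midpoint stays in \<open>K\<close>, so its squared distance to
      \<open>x\<close> is at least \<open>d\<close>; this leaves little room for
      \<open>k m - k n\<close>.\<close>
    define h where "h = scaleC (1/2) (k m + k n)"
    have hK: "h \<in> K" using kK K by (auto simp: h_def closed_csubspace_def)
    have "(x - k m) + (x - k n) = scaleC 2 (x - h)"
      by (rule cinner_ext) (simp add: h_def cinner_simps algebra_simps flip: add_divide_distrib)
    then have "N ((x - k m) + (x - k n)) = 4 * N (x - h)"
      by (simp add: N_def cinner_scaleC_left cinner_scaleC_right)
    moreover have "(x - k m) - (x - k n) = k n - k m" by simp
    ultimately have "4 * N (x - h) + N (k n - k m) = 2 * N (x - k m) + 2 * N (x - k n)"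
      using parallelogram[of "x - k m" "x - k n"] by (simp add: N_def)
    moreover have "N (k n - k m) = N (k m - k n)" by (simp add: N_def cinner_simps)
    ultimately show ?thesis using lower[OF hK] kd[of m] kd[of n] by simp
  qed
  have "\<exists>L. clim k L"
  proof (rule clim_ex)
    fix e :: real assume e: "e > 0"
    obtain n0 where n0: "4 / e\<^sup>2 < real n0" using reals_Archimedean2 by blast
    have "cnorm (k m - k n) < e" if "m \<ge> n0" "n \<ge> n0" for m n
    proof -
      have p: "0 < real n0" using n0 e by (smt (verit) divide_pos_pos zero_less_power)
      have "1 / real (Suc m) < 1 / real n0" "1 / real (Suc n) < 1 / real n0"
        using that p by (auto simp: frac_less2)
      then have "N (k m - k n) < 4 / real n0" using cau[of m n] by simp
      also have "\<dots> < e\<^sup>2" using n0 p e by (simp add: field_simps)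
      finally have "(cnorm (k m - k n))\<^sup>2 < e\<^sup>2" by (simp add: cnorm_sq N_def)
      then show ?thesis using e by (simp add: power_less_imp_less_base)
    qed
    then show "\<exists>N. \<forall>m\<ge>N. \<forall>n\<ge>N. cnorm (k m - k n) < e" by blast
  qed
  then obtain L where L: "clim k L" by blast
  have LK: "L \<in> K" using K L kK unfolding closed_csubspace_def by blast
  have "(\<lambda>n. (cnorm (x - k n))\<^sup>2) \<longlonglongrightarrow> (cnorm (x - L))\<^sup>2"
    by (intro tendsto_power clim_cnorm clim_diff clim_const L)
  moreover have "(\<lambda>n. d + 1 / real (Suc n)) \<longlonglongrightarrow> d + 0"
    by (intro tendsto_intros LIMSEQ_Suc[OF lim_const_over_n])
  ultimately have Ld: "N (x - L) \<le> d"
    using LIMSEQ_le[of _ _ _ "d + 0"] kd by (fastforce simp: cnorm_sq N_def less_imp_le)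
  have "cinner u (x - L) = 0" if u: "u \<in> K" for u
  proof -
    define z where "z = cinner u (x - L)"
    define b where "b = N u"
    have q: "0 \<le> - 2 * t * (cmod z)\<^sup>2 + t\<^sup>2 * (cmod z)\<^sup>2 * b" for t :: real
    proof -
      define w where "w = scaleC (of_real t * z) u"
      have "L + w \<in> K" using K LK u by (auto simp: w_def closed_csubspace_def)
      from lower[OF this] Ld have "N (x - L) \<le> N ((x - L) - w)" by (simp add: diff_diff_add)
      moreover have "N ((x - L) - w) = N (x - L) - 2 * t * (cmod z)\<^sup>2 + t\<^sup>2 * (cmod z)\<^sup>2 * b"
      proof -
        have 1: "cinner u u = of_real b" by (simp add: complex_eq_iff b_def N_def)
        have 2: "cinner (x - L) u = cnj z" using cinner_commute[of "x - L" u] by (simp add: z_def)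
        show ?thesis
          unfolding w_def cmod_power2 N_def cinner_diff_left[of "x - L"] cinner_diff_right[of _ "x - L"]
            cinner_scaleC_left cinner_scaleC_right 1 2 z_def[symmetric]
          by (simp add: algebra_simps power2_eq_square)
      qed
      ultimately show ?thesis by simp
    qed
    have b0: "b \<ge> 0" by (simp add: b_def N0)
    \<comment> \<open>Any \<open>t > 0\<close> with \<open>t * b < 2\<close> lets the linear term
      win; \<open>b + 1\<close> in place of \<open>b\<close> covers \<open>u = 0\<close>.\<close>
    define t where "t = 1 / (b + 1)"
    have t: "t > 0" "t * b < 1" using b0 by (auto simp: t_def field_simps)
    have "(cmod z)\<^sup>2 * (t * (2 - t * b)) \<le> 0"
      using q[of t] by (simp add: algebra_simps power2_eq_square)
    moreover have "t * (2 - t * b) > 0"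
      using t by (intro mult_pos_pos) auto
    ultimately have "(cmod z)\<^sup>2 \<le> 0"
      by (metis mult_le_0_iff not_le)
    then show ?thesis by (simp add: z_def)
  qed
  then show ?thesis using LK by blast
qed

text \<open>One continuity argument for two uses: a single pair gives the kernel of a functional,
  and all \<open>y\<close> together give the common kernel of a family of operators.\<close>

lemma closed_csubspace_annihilator:
  assumes "\<And>y A. (y, A) \<in> P \<Longrightarrow> bounded_op A"
  shows "closed_csubspace {x. \<forall>y A. (y, A) \<in> P \<longrightarrow> cinner y (A x) = 0}"
  unfolding closed_csubspace_def
proof (intro conjI ballI allI impI)
  fix X L assume XL: "(\<forall>n. X n \<in> {x. \<forall>y A. (y, A) \<in> P \<longrightarrow> cinner y (A x) = 0}) \<and> clim X L"
  have "cinner y (A L) = 0" if "(y, A) \<in> P" for y A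
  proof -
    have "(\<lambda>n. cinner y (A (X n))) \<longlonglongrightarrow> cinner y (A L)"
      using XL clim_bounded_op[OF assms[OF that]] clim_cinner by blast
    moreover have "(\<lambda>n. cinner y (A (X n))) = (\<lambda>n. 0)" using XL that by fastforce
    ultimately show ?thesis by (simp add: LIMSEQ_const_iff)
  qed
  then show "L \<in> {x. \<forall>y A. (y, A) \<in> P \<longrightarrow> cinner y (A x) = 0}" by auto
qed (fastforce simp: cinner_simps lin_simps dest: assms[THEN bounded_op_lin])+

lemma closed_csubspace_ker:
  assumes "\<And>A. A \<in> S \<Longrightarrow> bounded_op A"
  shows "closed_csubspace {x. \<forall>A\<in>S. A x = 0}"
proof -
  have "{x. \<forall>A\<in>S. A x = 0} = {x. \<forall>y A. (y, A) \<in> UNIV \<times> S \<longrightarrow> cinner y (A x) = 0}"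
    by (auto dest: cinner_eq_zero)
  then show ?thesis using closed_csubspace_annihilator[of "UNIV \<times> S"] assms by auto
qed

text \<open>Riesz representation of the functional sending \<open>x\<close> to
  \<open>cinner y (A x)\<close>: its kernel has codimension at most one, and a vector orthogonal to
  the kernel represents it after scaling.\<close>

lemma adjoint_ex:
  assumes A: "bounded_op A"
  shows "\<exists>B. \<forall>x y. cinner (A x) y = cinner x (B y)"
proof -
  note l = lin_simps[OF bounded_op_lin[OF A]]
  have "\<exists>z. \<forall>x. cinner (A x) y = cinner x z" for y
  proof -
    define K where "K = {x. cinner y (A x) = 0}"
    have K: "closed_csubspace K"
      using closed_csubspace_annihilator[of "{(y, A)}"] A by (simp add: K_def)
    show ?thesis
    proof (cases "K = UNIV")
      case True
      then have "cinner (A x) y = cinner x 0" for x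
        using cinner_commute[of "A x" y] by (auto simp: K_def)
      then show ?thesis by blast
    next
      case False
      then obtain u where u: "u \<notin> K" by blast
      from projection_theorem[OF K] obtain L
        where L: "L \<in> K" "\<And>k. k \<in> K \<Longrightarrow> cinner k (u - L) = 0" by metis
      define v where "v = u - L"
      define s where "s = cinner y (A v)"
      have s: "s \<noteq> 0" using u L(1) by (simp add: s_def v_def K_def l cinner_simps)
      then have v: "cinner v v \<noteq> 0" using cinner_eq_zero[of v] by (auto simp: s_def l)
      have "cinner (A x) y = cinner x (scaleC (cnj s / cinner v v) v)" for x
      proof -
        define f where "f = cinner y (A x)"
        \<comment> \<open>\<open>f\<close> and \<open>s\<close> are the values of the functional at
          \<open>x\<close> and \<open>v\<close>, so it vanishes on this combination.\<close>
        have "scaleC f v - scaleC s x \<in> K"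
          by (simp add: K_def l cinner_simps f_def s_def)
        then have "cinner (scaleC f v - scaleC s x) v = 0" using L(2) by (simp add: v_def)
        then have "cnj f * cinner v v = cnj s * cinner x v" by (simp add: cinner_simps)
        then have "cnj f = cnj s / cinner v v * cinner x v" using v by (simp add: field_simps)
        then show ?thesis using cinner_commute[of "A x" y] by (simp add: cinner_simps f_def)
      qed
      then show ?thesis by blast
    qed
  qed
  then have "\<forall>y. \<exists>z. \<forall>x. cinner (A x) y = cinner x z" by blast
  from choice[OF this] obtain B where B: "\<forall>y x. cinner (A x) y = cinner x (B y)" ..
  show ?thesis by (intro exI[of _ B] allI B[rule_format])
qed

lemma adj_eqI:
  assumes "\<And>x y. cinner (A x) y = cinner x (B y)"
  shows "adj A = B"
  unfolding adj_def
proof (rule the_equality)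
  fix C assume C: "\<forall>x y. cinner (A x) y = cinner x (C y)"
  show "C = B"
  proof (rule ext, rule cinner_ext)
    show "cinner z (C x) = cinner z (B x)" for x z using C assms[of z x] by simp
  qed
qed (use assms in blast)

lemma cinner_adj: "bounded_op A \<Longrightarrow> cinner (A x) y = cinner x (adj A y)"
proof -
  assume "bounded_op A"
  then obtain B where B: "\<And>x y. cinner (A x) y = cinner x (B y)" using adjoint_ex by meson
  show ?thesis unfolding adj_eqI[OF B] by (rule B)
qed

lemma cinner_adj_left: "bounded_op A \<Longrightarrow> cinner (adj A x) y = cinner x (A y)"
  using cinner_adj[of A y x] cinner_commute[of x "A y"] cinner_commute[of "adj A x" y] by simp

lemma bounded_op_adj: assumes A: "bounded_op A" shows "bounded_op (adj A)"
proof -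
  note c = cinner_adj[OF A, symmetric]
  have "lin (adj A)" unfolding lin_def
    by (intro conjI allI; rule cinner_ext) (simp_all add: c cinner_simps)
  moreover obtain K where K: "K > 0" "\<And>x. cnorm (A x) \<le> K * cnorm x"
    using bounded_op_bound[OF A] by blast
  have "cnorm (adj A x) \<le> K * cnorm x" for x
  proof -
    have "(cnorm (adj A x))\<^sup>2 = cmod (cinner (A (adj A x)) x)"
      by (simp only: cinner_adj[OF A] cinner_self) (simp add: norm_power)
    also have "\<dots> \<le> K * cnorm (adj A x) * cnorm x"
      using cinner_Cauchy_Schwarz[of "A (adj A x)" x] K(2)[of "adj A x"]
      by (meson cnorm_ge_0 mult_right_mono order_trans)
    finally have "cnorm (adj A x) * cnorm (adj A x) \<le> cnorm (adj A x) * (K * cnorm x)"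
      by (simp add: power2_eq_square mult_ac)
    then show ?thesis using K(1) by (intro mult_self_le_cancel[of "cnorm (adj A x)"]) auto
  qed
  ultimately show ?thesis unfolding bounded_op_iff by blast
qed

section \<open>Positive operators and projections\<close>

lemma bounded_op_ident: "bounded_op (\<lambda>x. x)"
  unfolding bounded_op_def by (auto intro!: exI[of _ 1])

lemma bounded_op_zero: "bounded_op (\<lambda>x. 0)"
  unfolding bounded_op_def by (auto intro!: exI[of _ 0] simp: cnorm_def)

lemma bounded_op_comp: assumes "bounded_op A" "bounded_op B" shows "bounded_op (\<lambda>x. A (B x))"
proof -
  obtain K where K: "K > 0" "\<And>x. cnorm (A x) \<le> K * cnorm x" using bounded_op_bound[OF assms(1)] by blast
  obtain L where L: "L > 0" "\<And>x. cnorm (B x) \<le> L * cnorm x" using bounded_op_bound[OF assms(2)] by blast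
  have "cnorm (A (B x)) \<le> (K * L) * cnorm x" for x
    using order_trans[OF K(2)[of "B x"] mult_left_mono[OF L(2)[of x], of K]] K(1) by (simp add: mult.assoc)
  then show ?thesis using assms unfolding bounded_op_iff by (auto simp: lin_def)
qed

lemma bounded_op_scaleC: assumes "bounded_op A" shows "bounded_op (\<lambda>x. scaleC c (A x))"
proof -
  have "bounded_op (scaleC c :: 'a \<Rightarrow> 'a)"
    unfolding bounded_op_def
    by (auto simp: scaleC_add_right scaleC_scaleC mult.commute cnorm_scaleC intro!: exI[of _ "cmod c"])
  then show ?thesis using assms by (rule bounded_op_comp)
qed

lemma bounded_op_add: assumes "bounded_op A" "bounded_op B" shows "bounded_op (\<lambda>x. A x + B x)"
proof -
  obtain K where K: "\<And>x. cnorm (A x) \<le> K * cnorm x" using bounded_op_bound[OF assms(1)] by blast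
  obtain L where L: "\<And>x. cnorm (B x) \<le> L * cnorm x" using bounded_op_bound[OF assms(2)] by blast
  have "cnorm (A x + B x) \<le> (K + L) * cnorm x" for x
    using K[of x] L[of x] cnorm_triangle[of "A x" "B x"] by (simp add: algebra_simps)
  moreover have "lin (\<lambda>x. A x + B x)"
    using assms unfolding bounded_op_def lin_def by (simp add: scaleC_add_right algebra_simps)
  ultimately show ?thesis unfolding bounded_op_iff by blast
qed

lemma bounded_op_diff: assumes "bounded_op A" "bounded_op B" shows "bounded_op (\<lambda>x. A x - B x)"
  using bounded_op_add[OF assms(1) bounded_op_scaleC[OF assms(2), of "-1"]] by (simp add: scaleC_minus1)

lemma pos_op_bounded: "pos_op A \<Longrightarrow> bounded_op A"
  and pos_op_lin: "pos_op A \<Longrightarrow> lin A"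
  and pos_op_Im: "pos_op A \<Longrightarrow> Im (cinner x (A x)) = 0"
  and pos_op_Re: "pos_op A \<Longrightarrow> 0 \<le> Re (cinner x (A x))"
  by (auto simp: pos_op_def bounded_op_lin)

lemma pos_op_sym: "pos_op A \<Longrightarrow> cinner (A x) y = cinner x (A y)"
  by (intro real_form_sesqui pos_op_lin pos_op_Im)

lemma pos_op_Cauchy_Schwarz:
  "pos_op A \<Longrightarrow> (cmod (cinner x (A y)))\<^sup>2 \<le> Re (cinner x (A x)) * Re (cinner y (A y))"
  by (intro positive_form_Cauchy_Schwarz pos_op_lin pos_op_Im pos_op_Re)

lemma pos_op_ident: "pos_op (\<lambda>x. x)"
  by (simp add: pos_op_def bounded_op_ident cinner_nonneg)

lemma pos_op_zero: "pos_op (\<lambda>x. 0)"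
  by (simp add: pos_op_def bounded_op_zero)

lemma pos_op_add: "pos_op A \<Longrightarrow> pos_op B \<Longrightarrow> pos_op (\<lambda>x. A x + B x)"
  by (simp add: pos_op_def bounded_op_add cinner_simps)

lemma pos_op_scaleC: "pos_op A \<Longrightarrow> r \<ge> 0 \<Longrightarrow> pos_op (\<lambda>x. scaleC (of_real r) (A x))"
  by (simp add: pos_op_def bounded_op_scaleC cinner_simps)

text \<open>The form of the difference vanishes identically, and Cauchy-Schwarz then kills the
  operator. Uniqueness of all suprema below rests on this.\<close>

lemma op_le_antisym: assumes "op_le A B" "op_le B A" shows "A = B"
proof
  fix x
  have "pos_op (\<lambda>x. B x - A x)" "pos_op (\<lambda>x. A x - B x)" using assms by (auto simp: op_le_def)
  note D = pos_op_Re[OF this(2)] this(1)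
  have "Re (cinner y (B y - A y)) = 0" for y
    using D(1)[of y] pos_op_Re[OF D(2), of y] by (simp add: cinner_simps)
  then have "(cmod (cinner z (B x - A x)))\<^sup>2 \<le> 0" for z
    using pos_op_Cauchy_Schwarz[OF D(2), of z x] by simp
  then have "cinner z (B x - A x) = 0" for z by simp
  then show "A x = B x" by (intro cinner_ext) (simp add: cinner_simps)
qed

lemma op_le_refl: "bounded_op A \<Longrightarrow> op_le A A"
  by (simp add: op_le_def pos_op_zero)

lemma op_le_Re: "op_le A B \<Longrightarrow> Re (cinner x (A x)) \<le> Re (cinner x (B x))"
  using pos_op_Re[of "\<lambda>x. B x - A x" x] by (simp add: op_le_def cinner_simps)

lemma op_leI:
  assumes "bounded_op A" "bounded_op B" "\<And>x. Im (cinner x (A x)) = Im (cinner x (B x))"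
    "\<And>x. Re (cinner x (A x)) \<le> Re (cinner x (B x))"
  shows "op_le A B"
  using assms by (simp add: op_le_def pos_op_def bounded_op_diff cinner_simps)

text \<open>This is \<open>A^2 \<le> c A\<close> for \<open>0 \<le> A \<le> c\<close>, from
  Cauchy-Schwarz for the form of \<open>A\<close> at \<open>x\<close> and \<open>A x\<close>. It
  turns convergence of quadratic forms into strong convergence.\<close>

lemma pos_op_norm_bound:
  assumes A: "pos_op A" and c: "c \<ge> 0" "\<And>x. Re (cinner x (A x)) \<le> c * (cnorm x)\<^sup>2"
  shows "(cnorm (A x))\<^sup>2 \<le> c * Re (cinner x (A x))"
proof -
  define m where "m = (cnorm (A x))\<^sup>2"
  have "cinner x (A (A x)) = of_real m"
    using pos_op_sym[OF A, of x "A x"] by (simp add: cinner_self m_def)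
  then have "m\<^sup>2 \<le> Re (cinner x (A x)) * Re (cinner (A x) (A (A x)))"
    using pos_op_Cauchy_Schwarz[OF A, of x "A x"] by (simp add: m_def norm_power)
  also have "\<dots> \<le> Re (cinner x (A x)) * (c * m)"
    using c(2)[of "A x"] pos_op_Re[OF A, of x] by (simp add: m_def mult_left_mono)
  finally have "m * m \<le> m * (c * Re (cinner x (A x)))" by (simp add: power2_eq_square mult_ac)
  moreover have "m \<ge> 0" by (simp add: m_def)
  moreover have "c * Re (cinner x (A x)) \<ge> 0" using c(1) pos_op_Re[OF A] by simp
  ultimately show ?thesis unfolding m_def[symmetric]
    by (metis mult_le_cancel_left_pos order_le_less)
qed

lemma pos_op_bound:
  assumes A: "pos_op A" and c: "c \<ge> 0" "\<And>x. Re (cinner x (A x)) \<le> c * (cnorm x)\<^sup>2"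
  shows "cnorm (A x) \<le> c * cnorm x"
proof (rule power2_le_imp_le)
  have "(cnorm (A x))\<^sup>2 \<le> c * (c * (cnorm x)\<^sup>2)"
    using pos_op_norm_bound[OF assms, of x] mult_left_mono[OF c(2)[of x] c(1)] by linarith
  then show "(cnorm (A x))\<^sup>2 \<le> (c * cnorm x)\<^sup>2" by (simp add: power2_eq_square mult_ac)
qed (simp add: c)

lemma bounded_op_form_bound:
  assumes "bounded_op A"
  obtains c where "c > 0" "\<And>x. Re (cinner x (A x)) \<le> c * (cnorm x)\<^sup>2"
proof -
  obtain K where K: "K > 0" "\<And>x. cnorm (A x) \<le> K * cnorm x" using bounded_op_bound[OF assms] by blast
  have "Re (cinner x (A x)) \<le> K * (cnorm x)\<^sup>2" for x
  proof -
    have "Re (cinner x (A x)) \<le> cnorm x * cnorm (A x)"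
      using complex_Re_le_cmod cinner_Cauchy_Schwarz order_trans by blast
    also have "\<dots> \<le> cnorm x * (K * cnorm x)" by (intro mult_left_mono K) simp
    finally show ?thesis by (simp add: power2_eq_square mult_ac)
  qed
  then show thesis using that K(1) by blast
qed

text \<open>Vigier: \<open>\<parallel>(A\<^sub>m - A\<^sub>n) x\<parallel>\<^sup>2 \<le> c \<langle>x, (A\<^sub>m - A\<^sub>n) x\<rangle>\<close>, and the quadratic forms converge.\<close>
lemma monotone_strong_limit:
  fixes A :: "nat \<Rightarrow> 'h::chilbert \<Rightarrow> 'h"
  assumes pos: "\<And>n. pos_op (A n)"
    and inc: "\<And>n. pos_op (\<lambda>x. A (Suc n) x - A n x)"
    and c: "c \<ge> 0" "\<And>n x. Re (cinner x (A n x)) \<le> c * (cnorm x)\<^sup>2"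
  shows "\<exists>B. pos_op B \<and> (\<forall>x. clim (\<lambda>n. A n x) (B x))"
proof -
  define q where "q = (\<lambda>x n. Re (cinner x (A n x)))"
  have "q x n \<le> q x (Suc n)" for x n
    using pos_op_Re[OF inc, of x n] by (simp add: q_def cinner_simps)
  then have mono: "incseq (q x)" for x by (simp add: incseq_SucI)
  have q0: "q x n \<ge> 0" for x n using pos_op_Re[OF pos] by (simp add: q_def)
  have diff: "(cnorm (A m x - A n x))\<^sup>2 \<le> c * (q x m - q x n)" if "n \<le> m" for m n x
  proof -
    have "q y n \<le> q y m" for y using incseqD[OF mono that] .
    then have "pos_op (\<lambda>x. A m x - A n x)"
      using pos[of m] pos[of n] by (simp add: pos_op_def bounded_op_diff cinner_simps q_def)
    moreover have "Re (cinner y (A m y - A n y)) \<le> c * (cnorm y)\<^sup>2" for y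
      using q0[of y n] c(2)[of y m] by (simp add: cinner_simps q_def)
    ultimately show ?thesis using pos_op_norm_bound[of "\<lambda>x. A m x - A n x" c x] c(1)
      by (simp add: q_def cinner_simps)
  qed
  have "\<exists>L. clim (\<lambda>n. A n x) L" for x
  proof (rule clim_ex)
    fix e :: real assume e: "e > 0"
    have "Bseq (q x)" using q0 c(2)[of x] by (intro BseqI'[of _ "c * (cnorm x)\<^sup>2"]) (simp add: q_def)
    then have "Cauchy (q x)"
      using Bseq_monoseq_convergent convergent_Cauchy mono incseq_imp_monoseq by blast
    \<comment> \<open>\<open>c + 1\<close> avoids dividing by \<open>c = 0\<close>.\<close>
    moreover have "e\<^sup>2 / (c + 1) > 0" using e c(1) by simp
    ultimately obtain N where N: "\<And>m n. m \<ge> N \<Longrightarrow> n \<ge> N \<Longrightarrow> dist (q x m) (q x n) < e\<^sup>2 / (c + 1)"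
      unfolding Cauchy_def by blast
    have le: "cnorm (A m x - A n x) < e" if "N \<le> n" "n \<le> m" for m n
    proof -
      have "0 \<le> q x m - q x n" using incseqD[OF mono that(2)] by simp
      then have "c * (q x m - q x n) \<le> (c + 1) * (q x m - q x n)" by (simp add: mult_right_mono)
      also have "(c + 1) * (q x m - q x n) < (c + 1) * (e\<^sup>2 / (c + 1))"
        using N[of m n] that c(1) by (intro mult_strict_left_mono) (auto simp: dist_real_def)
      also have "\<dots> = e\<^sup>2" using c(1) by simp
      finally have "(cnorm (A m x - A n x))\<^sup>2 < e\<^sup>2" using diff[OF that(2), of x] by linarith
      then show ?thesis using e by (simp add: power_less_imp_less_base)
    qed
    have "cnorm (A m x - A n x) < e" if "N \<le> n" "N \<le> m" for m n
      using le[of n m] le[of m n] that cnorm_minus_commute[of "A m x" "A n x"] by (cases "n \<le> m") auto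
    then show "\<exists>N. \<forall>m\<ge>N. \<forall>n\<ge>N. cnorm (A m x - A n x) < e" by blast
  qed
  then have "\<forall>x. \<exists>L. clim (\<lambda>n. A n x) L" by blast
  from choice[OF this] obtain B where B: "\<And>x. clim (\<lambda>n. A n x) (B x)" by blast
  have "B (x + y) = B x + B y" for x y
    using clim_unique[OF B[of "x + y"]] clim_add[OF B[of x] B[of y]] by (simp add: lin_add[OF pos_op_lin[OF pos]])
  moreover have "B (scaleC a x) = scaleC a (B x)" for a x
    using clim_unique[OF B[of "scaleC a x"]] clim_scaleC[OF B[of x]] by (simp add: lin_scaleC[OF pos_op_lin[OF pos]])
  moreover have "cnorm (B x) \<le> c * cnorm x" for x
    using LIMSEQ_le_const2[OF clim_cnorm[OF B[of x]]] pos_op_bound[OF pos c] by blast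
  ultimately have "bounded_op B" unfolding bounded_op_def by blast
  moreover have "Im (cinner x (B x)) = 0 \<and> 0 \<le> Re (cinner x (B x))" for x
  proof -
    note l = clim_cinner[OF B[of x], of x]
    have "(\<lambda>n. 0) \<longlonglongrightarrow> Im (cinner x (B x))"
      using tendsto_Im[OF l] by (simp add: pos_op_Im[OF pos])
    moreover have "0 \<le> Re (cinner x (B x))"
      using LIMSEQ_le_const[OF tendsto_Re[OF l]] pos_op_Re[OF pos] by blast
    ultimately show ?thesis by (simp add: LIMSEQ_const_iff)
  qed
  ultimately show ?thesis using B by (auto simp: pos_op_def)
qed

section \<open>Orthogonal projections and their order\<close>

lemma orth_projI:
  assumes "bounded_op P" "\<And>x. P (P x) = P x" "\<And>x y. cinner (P x) y = cinner x (P y)"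
  shows "orth_proj P"
  unfolding orth_proj_def using assms by (auto intro!: adj_eqI)

lemma orth_proj_bounded: "orth_proj P \<Longrightarrow> bounded_op P"
  and orth_proj_lin: "orth_proj P \<Longrightarrow> lin P"
  and orth_proj_idem: "orth_proj P \<Longrightarrow> P (P x) = P x"
  by (auto simp: orth_proj_def bounded_op_lin fun_eq_iff)

lemma orth_proj_sym: "orth_proj P \<Longrightarrow> cinner (P x) y = cinner x (P y)"
  using cinner_adj[of P x y] by (simp add: orth_proj_def)

lemma orth_proj_cinner: "orth_proj P \<Longrightarrow> cinner x (P x) = of_real ((cnorm (P x))\<^sup>2)"
  using orth_proj_sym[of P x "P x"] by (simp add: orth_proj_idem cinner_self)

lemma orth_proj_pos: "orth_proj P \<Longrightarrow> pos_op P"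
  by (simp add: pos_op_def orth_proj_cinner orth_proj_bounded)

lemma orth_proj_compl: assumes P: "orth_proj P" shows "orth_proj (\<lambda>x. x - P x)"
proof (rule orth_projI)
  show "bounded_op (\<lambda>x. x - P x)" by (intro bounded_op_diff bounded_op_ident orth_proj_bounded P)
qed (auto simp: lin_simps[OF orth_proj_lin[OF P]] orth_proj_idem[OF P] cinner_simps orth_proj_sym[OF P])

lemma orth_proj_contraction: assumes P: "orth_proj P" shows "cnorm (P x) \<le> cnorm x"
proof -
  have "(cnorm (P x))\<^sup>2 = cmod (cinner x (P x))" by (simp add: orth_proj_cinner[OF P] norm_power)
  also have "\<dots> \<le> cnorm x * cnorm (P x)" by (rule cinner_Cauchy_Schwarz)
  finally have "cnorm (P x) * cnorm (P x) \<le> cnorm (P x) * cnorm x"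
    by (simp add: power2_eq_square mult_ac)
  then show ?thesis by (intro mult_self_le_cancel[of "cnorm (P x)"]) auto
qed

text \<open>Since \<open>x - Q x\<close> lies in the kernel of \<open>Q\<close>, the kernel
  inclusion gives \<open>P = P Q\<close>, and \<open>P\<close> is a contraction. Transitivity and
  suprema become statements about kernels.\<close>

lemma orth_proj_le_iff:
  assumes P: "orth_proj P" and Q: "orth_proj Q"
  shows "op_le P Q \<longleftrightarrow> (\<forall>x. Q x = 0 \<longrightarrow> P x = 0)"
proof (intro iffI allI impI)
  fix x assume "op_le P Q" "Q x = 0"
  then have "(cnorm (P x))\<^sup>2 \<le> 0"
    using op_le_Re[of P Q x] by (simp add: orth_proj_cinner[OF P])
  then show "P x = 0" by simp
next
  assume z: "\<forall>x. Q x = 0 \<longrightarrow> P x = 0"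
  have "P x = P (Q x)" for x
    using z[rule_format, of "x - Q x"]
    by (simp add: lin_diff[OF orth_proj_lin[OF Q]] lin_diff[OF orth_proj_lin[OF P]] orth_proj_idem[OF Q])
  then have "cnorm (P x) \<le> cnorm (Q x)" for x using orth_proj_contraction[OF P] by metis
  then show "op_le P Q"
    by (intro op_leI) (auto simp: orth_proj_bounded P Q orth_proj_cinner intro: power_mono)
qed

lemma orth_proj_onto:
  fixes K :: "'h::chilbert set"
  assumes K: "closed_csubspace K"
  shows "\<exists>P. orth_proj P \<and> (\<forall>x. P x \<in> K) \<and> (\<forall>x\<in>K. P x = x)"
proof -
  have "\<forall>x. \<exists>L. L \<in> K \<and> (\<forall>k\<in>K. cinner k (x - L) = 0)" using projection_theorem[OF K] by blast
  from choice[OF this] obtain P where PK: "\<And>x. P x \<in> K" and o: "\<And>x k. k \<in> K \<Longrightarrow> cinner k (x - P x) = 0"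
    by blast
  have uniq: "P x = L" if "L \<in> K" "\<And>k. k \<in> K \<Longrightarrow> cinner k (x - L) = 0" for x L
  proof -
    have "P x - L \<in> K" using PK that(1) closed_csubspace_diff[OF K] by blast
    then have "cinner (P x - L) (x - L - (x - P x)) = 0"
      using o that(2) by (simp only: cinner_diff_right[of _ "x - L"] diff_self)
    then show ?thesis using cinner_eq_zero[of "P x - L"] by simp
  qed
  have id_K: "P x = x" if "x \<in> K" for x using uniq[OF that] by simp
  have sym: "cinner (P x) y = cinner x (P y)" for x y
  proof -
    have "cinner (P x) y = cinner (P x) (P y)" using o[OF PK, of x y] by (simp add: cinner_simps)
    moreover have "cinner (P y) x = cinner (P y) (P x)" using o[OF PK, of y x] by (simp add: cinner_simps)
    ultimately show ?thesis using cinner_commute[of x "P y"] cinner_commute[of "P x" "P y"] by simp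
  qed
  \<comment> \<open>\<open>P\<close> was chosen pointwise; its linearity comes from its
    symmetry.\<close>
  have "lin P" unfolding lin_def
    by (intro conjI allI; rule cinner_ext) (simp_all add: sym[symmetric] cinner_simps)
  moreover have "cnorm (P x) \<le> 1 * cnorm x" for x
  proof -
    have "(cnorm (P x))\<^sup>2 = cmod (cinner (P x) x)" using o[OF PK, of x x] by (simp add: cinner_simps cinner_self norm_power)
    also have "\<dots> \<le> cnorm (P x) * cnorm x" by (rule cinner_Cauchy_Schwarz)
    finally have "cnorm (P x) * cnorm (P x) \<le> cnorm (P x) * cnorm x" by (simp add: power2_eq_square)
    then show ?thesis by (intro mult_self_le_cancel[of "cnorm (P x)"]) auto
  qed
  ultimately have "bounded_op P" unfolding bounded_op_iff by blast
  then have "orth_proj P" by (rule orth_projI) (auto simp: id_K PK sym)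
  then show ?thesis using PK id_K by blast
qed

section \<open>Square roots\<close>

text \<open>The operators \<open>f(g)\<close> for polynomials \<open>f\<close> with nonnegative
  coefficients. As an inductive set they give positivity, commutation and closure under products by
  rule induction, without coefficients.\<close>

inductive_set pow_cone :: "('h::chilbert \<Rightarrow> 'h) \<Rightarrow> ('h \<Rightarrow> 'h) set" for g where
  pow: "(g ^^ k) \<in> pow_cone g"
| add: "A \<in> pow_cone g \<Longrightarrow> B \<in> pow_cone g \<Longrightarrow> (\<lambda>x. A x + B x) \<in> pow_cone g"
| scale: "A \<in> pow_cone g \<Longrightarrow> r \<ge> 0 \<Longrightarrow> (\<lambda>x. scaleC (of_real r) (A x)) \<in> pow_cone g"

text \<open>Induction in steps of two: the form of \<open>g^(j+2)\<close> at \<open>x\<close> is the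
  form of \<open>g^j\<close> at \<open>g x\<close>.\<close>

lemma pos_op_funpow: assumes g: "pos_op g" shows "pos_op (g ^^ k)"
proof (induction k rule: less_induct)
  case (less k)
  consider "k = 0" | "k = 1" | j where "k = Suc (Suc j)" by (metis One_nat_def not0_implies_Suc)
  then show ?case
  proof cases
    case 3
    have e: "(g ^^ k) = (\<lambda>x. g ((g ^^ j) (g x)))" unfolding 3 by (auto simp: funpow_swap1)
    have p: "pos_op (g ^^ j)" using less 3 by simp
    have "bounded_op (\<lambda>x. g ((g ^^ j) (g x)))"
      using bounded_op_comp[OF pos_op_bounded[OF g] bounded_op_comp[OF pos_op_bounded[OF p] pos_op_bounded[OF g]]] .
    then show ?thesis
      unfolding e pos_op_def pos_op_sym[OF g, symmetric] using pos_op_Im[OF p] pos_op_Re[OF p] by blast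
  qed (use g pos_op_ident in \<open>auto simp: id_def\<close>)
qed

lemma pow_cone_pos: "A \<in> pow_cone g \<Longrightarrow> pos_op g \<Longrightarrow> pos_op A"
  by (induction rule: pow_cone.induct) (auto intro: pos_op_funpow pos_op_add pos_op_scaleC)

lemma pow_cone_commute:
  assumes "A \<in> pow_cone g" "lin B" "\<And>x. B (g x) = g (B x)"
  shows "B (A x) = A (B x)"
  using assms(1)
proof (induction arbitrary: x rule: pow_cone.induct)
  case (pow k) then show ?case by (induction k) (auto simp: assms(3))
qed (auto simp: lin_simps[OF assms(2)])

lemma pow_cone_comp:
  assumes g: "pos_op g" and A: "A \<in> pow_cone g" and B: "B \<in> pow_cone g"
  shows "(\<lambda>x. A (B x)) \<in> pow_cone g"
  using A
proof (induction rule: pow_cone.induct)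
  case (pow k)
  from B show ?case
  proof (induction rule: pow_cone.induct)
    case (pow l)
    show ?case using pow_cone.pow[where g = g and k = "k + l"] by (simp add: funpow_add comp_def)
  qed (auto simp: lin_simps[OF pos_op_lin[OF pos_op_funpow[OF g]]] intro: pow_cone.intros)
qed (auto intro: pow_cone.intros)

text \<open>A fixed point \<open>y = (g + y\<^sup>2) / 2\<close> of the iteration satisfies \<open>(1 - y)\<^sup>2 = 1 - g\<close>. All iterates and
  their increments lie in the cone, where positivity is evident.\<close>
primrec visser :: "('h::chilbert \<Rightarrow> 'h) \<Rightarrow> nat \<Rightarrow> 'h \<Rightarrow> 'h" where
  "visser g 0 = (\<lambda>x. 0)"
| "visser g (Suc n) = (\<lambda>x. scaleC (of_real (1/2)) (g x + visser g n (visser g n x)))"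

lemma visser_cone: assumes g: "pos_op g" shows "visser g n \<in> pow_cone g"
proof (induction n)
  case 0
  have "(\<lambda>x. scaleC (of_real 0) ((g ^^ 0) x)) \<in> pow_cone g" by (intro pow_cone.intros) simp
  then show ?case by simp
next
  case (Suc n)
  have "g \<in> pow_cone g" using pow_cone.pow[where g = g and k = 1] by simp
  from pow_cone.scale[OF pow_cone.add[OF this pow_cone_comp[OF g Suc Suc]], of "1/2"]
  show ?case by simp
qed

lemma visser_comm:
  assumes g: "pos_op g" shows "visser g m (visser g n x) = visser g n (visser g m x)"
proof (rule pow_cone_commute[OF visser_cone[OF g]])
  show "lin (visser g m)" using pow_cone_pos[OF visser_cone[OF g] g] by (rule pos_op_lin)
  show "visser g m (g x) = g (visser g m x)" for x
    using pow_cone_commute[OF visser_cone[OF g] pos_op_lin[OF g]] by simp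
qed

text \<open>Differences generally leave the cone. With consecutive iterates \<open>u\<close>,
  \<open>v\<close>, which commute, \<open>v^2 - u^2 = v (v - u) + u (v - u)\<close> is again built
  from cone elements.\<close>

lemma visser_increment_cone:
  assumes g: "pos_op g" shows "(\<lambda>x. visser g (Suc n) x - visser g n x) \<in> pow_cone g"
proof (induction n)
  case 0
  show ?case using visser_cone[OF g, of 1] by simp
next
  case (Suc n)
  define u v where "u = visser g n" and "v = visser g (Suc n)"
  have l: "lin u" "lin v"
    unfolding u_def v_def by (rule pos_op_lin[OF pow_cone_pos[OF visser_cone[OF g] g]])+
  have vx: "v x = scaleC (of_real (1/2)) (g x + u (u x))" for x by (simp add: v_def u_def)
  have wx: "visser g (Suc (Suc n)) x = scaleC (of_real (1/2)) (g x + v (v x))" for x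
    unfolding v_def by (rule visser.simps(2)[THEN fun_cong])
  have "u (v x) = v (u x)" for x unfolding u_def v_def by (rule visser_comm[OF g])
  then have "v (v x) - u (u x) = v (v x - u x) + u (v x - u x)" for x
    by (simp add: lin_diff[OF l(1)] lin_diff[OF l(2)])
  moreover have "visser g (Suc (Suc n)) x - v x = scaleC (of_real (1/2)) (v (v x) - u (u x))" for x
    using arg_cong2[where f = "(-)", OF wx[of x] vx[of x]] by (simp flip: scaleC_diff_right)
  ultimately have "(\<lambda>x. visser g (Suc (Suc n)) x - v x)
      = (\<lambda>x. scaleC (of_real (1/2)) (v (v x - u x) + u (v x - u x)))"
    by simp
  also have "\<dots> \<in> pow_cone g"
    unfolding u_def v_def
    by (rule pow_cone.scale[OF pow_cone.add[OF pow_cone_comp[OF g visser_cone[OF g] Suc]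
            pow_cone_comp[OF g visser_cone[OF g] Suc]]]) simp
  finally show ?case unfolding v_def .
qed

text \<open>With \<open>g = 1 - a\<close> the iterates increase to a fixed point \<open>Z\<close>,
  and \<open>b = 1 - Z\<close>. The commutation clause holds because every iterate is a polynomial
  in \<open>g\<close>.\<close>

lemma sqrt_op_ex:
  assumes a: "pos_op a" and a1: "\<And>x. Re (cinner x (a x)) \<le> (cnorm x)\<^sup>2"
  shows "\<exists>b. pos_op b \<and> (\<forall>x. b (b x) = a x) \<and>
    (\<forall>B. bounded_op B \<and> (\<forall>x. B (a x) = a (B x)) \<longrightarrow> (\<forall>x. B (b x) = b (B x)))"
proof -
  define g where "g = (\<lambda>x. x - a x)"
  have g: "pos_op g" using a a1
    by (simp add: g_def pos_op_def bounded_op_diff bounded_op_ident cinner_simps cnorm_sq)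
  have gc: "cnorm (g x) \<le> cnorm x" for x
    using pos_op_bound[OF g, of 1 x] pos_op_Re[OF a] by (simp add: g_def cinner_simps cnorm_sq)
  let ?Y = "visser g"
  have Ypos: "pos_op (?Y n)" for n by (rule pow_cone_pos[OF visser_cone[OF g] g])
  have Yc: "cnorm (?Y n x) \<le> cnorm x" for n x
  proof (induction n arbitrary: x)
    case 0 then show ?case by (simp add: cnorm_def cinner_nonneg)
  next
    case (Suc n)
    have "cnorm (g x + ?Y n (?Y n x)) \<le> cnorm x + cnorm x"
      using cnorm_triangle[of "g x" "?Y n (?Y n x)"] gc[of x] Suc[of "?Y n x"] Suc[of x] by linarith
    then show ?case by (simp add: cnorm_scaleC)
  qed
  have contr: "Re (cinner x y) \<le> 1 * (cnorm x)\<^sup>2" if "cnorm y \<le> cnorm x" for x y :: 'a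
    using complex_Re_le_cmod[of "cinner x y"] cinner_Cauchy_Schwarz[of x y]
      mult_left_mono[OF that cnorm_ge_0[of x]] by (simp add: power2_eq_square)
  have "\<exists>B. pos_op B \<and> (\<forall>x. clim (\<lambda>n. ?Y n x) (B x))"
  proof (rule monotone_strong_limit)
    show "pos_op (\<lambda>x. ?Y (Suc n) x - ?Y n x)" for n
      by (rule pow_cone_pos[OF visser_increment_cone[OF g] g])
    show "Re (cinner x (?Y n x)) \<le> 1 * (cnorm x)\<^sup>2" for n x using contr Yc .
  qed (auto intro: Ypos)
  then obtain Z where Z: "pos_op Z" "\<And>x. clim (\<lambda>n. ?Y n x) (Z x)" by blast
  have Zc: "cnorm (Z x) \<le> cnorm x" for x
    using LIMSEQ_le_const2[OF clim_cnorm[OF Z(2)[of x]]] Yc by blast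
  \<comment> \<open>Strong limits pass to squares because the iterates are uniformly contractive:
    split \<open>?Y n (?Y n x)\<close> as \<open>?Y n (?Y n x - Z x) + ?Y n (Z x)\<close>.\<close>
  have YY: "clim (\<lambda>n. ?Y n (?Y n x)) (Z (Z x))" for x
  proof -
    have "clim (\<lambda>n. ?Y n (?Y n x - Z x)) 0"
    proof (rule clim_dominated[where K = 1, OF Z(2)[of x]])
      show "cnorm (?Y n (?Y n x - Z x) - 0) \<le> 1 * cnorm (?Y n x - Z x)" for n using Yc by simp
    qed
    from clim_add[OF this Z(2)[of "Z x"]] show ?thesis
      by (simp add: lin_diff[OF pos_op_lin[OF Ypos]])
  qed
  have fixpt: "Z x = scaleC (of_real (1/2)) (g x + Z (Z x))" for x
  proof (rule clim_unique)
    show "clim (\<lambda>n. ?Y (Suc n) x) (Z x)" by (rule clim_Suc[OF Z(2)])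
    show "clim (\<lambda>n. ?Y (Suc n) x) (scaleC (of_real (1/2)) (g x + Z (Z x)))"
      unfolding visser.simps by (intro clim_scaleC clim_add clim_const YY)
  qed
  have two: "Z x + Z x = x - a x + Z (Z x)" for x
  proof -
    have "scaleC 2 (Z x) = scaleC 2 (scaleC (of_real (1/2)) (g x + Z (Z x)))" using fixpt[of x] by simp
    then have "scaleC (1 + 1) (Z x) = g x + Z (Z x)" by (simp add: scaleC_scaleC scaleC_one)
    then show ?thesis by (simp only: scaleC_add_left scaleC_one g_def)
  qed
  define b where "b = (\<lambda>x. x - Z x)"
  have "pos_op b"
    using Z(1) contr[OF Zc] by (simp add: b_def pos_op_def bounded_op_diff bounded_op_ident cinner_simps cnorm_sq)
  moreover have "b (b x) = a x" for x
    using two[of x] by (simp add: b_def lin_diff[OF pos_op_lin[OF Z(1)]]) (simp add: algebra_simps)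
  moreover have "B (b x) = b (B x)" if B: "bounded_op B" "\<forall>x. B (a x) = a (B x)" for B x
  proof -
    have "B (g x) = g (B x)" for x using B by (simp add: g_def lin_diff[OF bounded_op_lin[OF B(1)]])
    then have "B (?Y n x) = ?Y n (B x)" for n
      by (intro pow_cone_commute[OF visser_cone[OF g] bounded_op_lin[OF B(1)]])
    then have "clim (\<lambda>n. ?Y n (B x)) (B (Z x))" using clim_bounded_op[OF B(1) Z(2)[of x]] by simp
    from clim_unique[OF this Z(2)] show ?thesis by (simp add: b_def lin_diff[OF bounded_op_lin[OF B(1)]])
  qed
  ultimately show ?thesis by blast
qed

section \<open>Von Neumann algebras\<close>

lemma commutant_bounded: "B \<in> commutant S \<Longrightarrow> bounded_op B"
  and commutant_lin: "B \<in> commutant S \<Longrightarrow> lin B"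
  and commutant_commute: "B \<in> commutant S \<Longrightarrow> A \<in> S \<Longrightarrow> B (A x) = A (B x)"
  by (auto simp: commutant_def bounded_op_lin fun_eq_iff)

text \<open>The bicommutant condition as a working criterion; all closure properties of
  \<open>M\<close> below reduce to commutation with its commutant.\<close>

lemma vna_iff:
  assumes "von_neumann_algebra M"
  shows "A \<in> M \<longleftrightarrow> bounded_op A \<and> (\<forall>B\<in>commutant M. \<forall>x. B (A x) = A (B x))"
proof -
  have "A \<in> M \<longleftrightarrow> A \<in> commutant (commutant M)" using assms by (simp add: von_neumann_algebra_def)
  then show ?thesis by (auto simp: commutant_def[of "commutant M"] fun_eq_iff)
qed

lemma vna_bounded: "von_neumann_algebra M \<Longrightarrow> A \<in> M \<Longrightarrow> bounded_op A"
  by (auto simp: vna_iff)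

lemma vna_ident: "von_neumann_algebra M \<Longrightarrow> (\<lambda>x. x) \<in> M"
  by (auto simp: vna_iff bounded_op_ident)

lemma vna_zero: "von_neumann_algebra M \<Longrightarrow> (\<lambda>x. 0) \<in> M"
  by (auto simp: vna_iff bounded_op_zero lin_0[OF commutant_lin])

lemma vna_add: "von_neumann_algebra M \<Longrightarrow> A \<in> M \<Longrightarrow> B \<in> M \<Longrightarrow> (\<lambda>x. A x + B x) \<in> M"
  by (auto simp: vna_iff bounded_op_add lin_add[OF commutant_lin])

lemma vna_diff: "von_neumann_algebra M \<Longrightarrow> A \<in> M \<Longrightarrow> B \<in> M \<Longrightarrow> (\<lambda>x. A x - B x) \<in> M"
  by (auto simp: vna_iff bounded_op_diff lin_diff[OF commutant_lin])

lemma vna_scaleC: "von_neumann_algebra M \<Longrightarrow> A \<in> M \<Longrightarrow> (\<lambda>x. scaleC c (A x)) \<in> M"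
  by (auto simp: vna_iff bounded_op_scaleC lin_scaleC[OF commutant_lin])

lemma vna_strong_limit:
  assumes M: "von_neumann_algebra M" and A: "\<And>n. A n \<in> M" and L: "bounded_op L"
    and lim: "\<And>x. clim (\<lambda>n. A n x) (L x)"
  shows "L \<in> M"
  unfolding vna_iff[OF M]
proof (intro conjI ballI allI L)
  fix B x assume B: "B \<in> commutant M"
  have "clim (\<lambda>n. A n (B x)) (B (L x))"
    using clim_bounded_op[OF commutant_bounded[OF B] lim[of x]] by (simp add: commutant_commute[OF B A])
  from clim_unique[OF this lim] show "B (L x) = L (B x)" .
qed

text \<open>Makes invariance under the commutant two-sided: an invariant subspace is also invariant
  under the adjoints.\<close>

lemma commutant_adj:
  assumes M: "von_neumann_algebra M" and B: "B \<in> commutant M"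
  shows "adj B \<in> commutant M"
proof -
  note Bb = commutant_bounded[OF B]
  have "adj B (A x) = A (adj B x)" if A: "A \<in> M" for A x
  proof (rule cinner_ext)
    fix z
    note Ab = vna_bounded[OF M A]
    have A': "adj A \<in> M" using M A by (simp add: von_neumann_algebra_def)
    have "cinner z (adj B (A x)) = cinner (B z) (A x)" by (simp only: cinner_adj[OF Bb])
    also have "\<dots> = cinner (adj A (B z)) x" by (simp only: cinner_adj_left[OF Ab])
    also have "\<dots> = cinner (B (adj A z)) x" by (simp only: commutant_commute[OF B A'])
    also have "\<dots> = cinner z (A (adj B x))" by (simp only: cinner_adj[OF Bb] cinner_adj_left[OF Ab])
    finally show "cinner z (adj B (A x)) = cinner z (A (adj B x))" .
  qed
  then show ?thesis using bounded_op_adj[OF Bb] by (auto simp: commutant_def fun_eq_iff)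
qed

text \<open>Invariance under \<open>B\<close> gives \<open>P B P = B P\<close>; invariance under
  \<open>adj B\<close> gives \<open>P B P = P B\<close> after taking adjoints. So \<open>P\<close>
  commutes with the commutant.\<close>

lemma vna_proj_onto:
  assumes M: "von_neumann_algebra M" and K: "closed_csubspace K"
    and inv: "\<And>B x. B \<in> commutant M \<Longrightarrow> x \<in> K \<Longrightarrow> B x \<in> K"
  shows "\<exists>P\<in>M. orth_proj P \<and> (\<forall>x. P x \<in> K) \<and> (\<forall>x\<in>K. P x = x)"
proof -
  obtain P where P: "orth_proj P" and PK: "\<And>x. P x \<in> K" and Pid: "\<And>x. x \<in> K \<Longrightarrow> P x = x"
    using orth_proj_onto[OF K] by blast
  have "B (P x) = P (B x)" if B: "B \<in> commutant M" for B x
  proof (rule cinner_ext)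
    fix z
    note Bb = commutant_bounded[OF B] and s = orth_proj_sym[OF P]
    have K1: "P (B (P x)) = B (P x)" by (rule Pid[OF inv[OF B PK]])
    have K2: "P (adj B (P z)) = adj B (P z)" by (rule Pid[OF inv[OF commutant_adj[OF M B] PK]])
    have "cinner z (P (B x)) = cinner (adj B (P z)) x"
      by (simp only: s[symmetric] cinner_adj_left[OF Bb])
    also have "\<dots> = cinner (P (adj B (P z))) x" by (simp only: K2)
    also have "\<dots> = cinner z (P (B (P x)))" by (simp only: s cinner_adj_left[OF Bb])
    also have "\<dots> = cinner z (B (P x))" by (simp only: K1)
    finally show "cinner z (B (P x)) = cinner z (P (B x))" by simp
  qed
  then have "P \<in> M" using orth_proj_bounded[OF P] by (simp add: vna_iff[OF M])
  then show ?thesis using P PK Pid by blast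
qed

section \<open>Suprema of projections\<close>

lemma is_proj_sup_least:
  "is_proj_sup M S s \<Longrightarrow> orth_proj r \<Longrightarrow> r \<in> M \<Longrightarrow> (\<And>p. p \<in> S \<Longrightarrow> op_le p r) \<Longrightarrow> op_le s r"
  by (simp add: is_proj_sup_def)

lemma is_proj_sup_unique: "is_proj_sup M S s \<Longrightarrow> is_proj_sup M S t \<Longrightarrow> s = t"
  by (intro op_le_antisym) (auto simp: is_proj_sup_def)

text \<open>The supremum is the complement of the projection onto the common kernel of
  \<open>S\<close>, a subspace invariant under the commutant.\<close>

lemma is_proj_sup_ex:
  assumes M: "von_neumann_algebra M" and S: "\<And>p. p \<in> S \<Longrightarrow> orth_proj p" "S \<subseteq> M"
  shows "\<exists>s. is_proj_sup M S s"
proof -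
  define N where "N = {x. \<forall>p\<in>S. p x = 0}"
  have "closed_csubspace N" unfolding N_def using S by (intro closed_csubspace_ker orth_proj_bounded)
  moreover have "B x \<in> N" if B: "B \<in> commutant M" and "x \<in> N" for B x
  proof -
    have "p (B x) = 0" if "p \<in> S" for p
    proof -
      have "p x = 0" "p \<in> M" using \<open>x \<in> N\<close> S(2) that by (auto simp: N_def)
      then show ?thesis using commutant_commute[OF B, of p x] lin_0[OF commutant_lin[OF B]] by simp
    qed
    then show ?thesis by (simp add: N_def)
  qed
  ultimately obtain F where FM: "F \<in> M" and F: "orth_proj F" "\<And>x. F x \<in> N" "\<And>x. x \<in> N \<Longrightarrow> F x = x"
    using vna_proj_onto[OF M, of N] by blast
  define s where "s = (\<lambda>x. x - F x)"
  have s: "orth_proj s" "s \<in> M"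
    unfolding s_def by (rule orth_proj_compl[OF F(1)], intro vna_diff vna_ident M FM)
  have "op_le p s" if "p \<in> S" for p
  proof -
    have "p x = 0" if "s x = 0" for x
      using F(2)[of x] that \<open>p \<in> S\<close> by (auto simp: N_def s_def)
    then show ?thesis using orth_proj_le_iff[OF S(1)[OF that] s(1)] by blast
  qed
  moreover have "op_le s r" if r: "orth_proj r" "\<forall>p\<in>S. op_le p r" for r
  proof -
    have "s x = 0" if "r x = 0" for x
    proof -
      have "x \<in> N" using r orth_proj_le_iff[OF S(1) r(1)] that by (auto simp: N_def)
      then show ?thesis by (simp add: s_def F)
    qed
    then show ?thesis using orth_proj_le_iff[OF s(1) r(1)] by blast
  qed
  ultimately show ?thesis using s unfolding is_proj_sup_def by blast
qed

text \<open>With \<open>y\<close> a positive multiple of \<open>x - e\<close>, the kernel of \<open>\<bar>y\<bar> + y\<close> is the spectral subspace of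
  \<open>x\<close> for \<open>[0, e]\<close>: \<open>y = -\<bar>y\<bar>\<close> on it, and \<open>y = \<bar>y\<bar>\<close> on its orthogonal complement.\<close>
lemma spectral_projection_ex:
  assumes M: "von_neumann_algebra M" and x: "x \<in> M" "pos_op x" and e: "e > 0"
  shows "\<exists>q\<in>M. orth_proj q \<and> op_le (\<lambda>v. scaleC (of_real e) (q v)) x
    \<and> (\<forall>v. q v = 0 \<longrightarrow> Re (cinner v (x v)) \<le> e * (cnorm v)\<^sup>2)"
proof -
  note xb = pos_op_bounded[OF x(2)] and xs = pos_op_sym[OF x(2)]
  define z where "z = (\<lambda>v. x v - scaleC (of_real e) v)"
  have zb: "bounded_op z" unfolding z_def by (intro bounded_op_diff xb bounded_op_scaleC bounded_op_ident)
  obtain C where C: "C > 0" "\<And>v. cnorm (z v) \<le> C * cnorm v" using bounded_op_bound[OF zb] by blast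
  \<comment> \<open>Scaling by \<open>1 / C\<close> makes \<open>y\<close> a contraction, so that
    \<open>y^2 \<le> 1\<close> as \<open>sqrt_op_ex\<close> demands.\<close>
  define y where "y = (\<lambda>v. scaleC (of_real (1 / C)) (z v))"
  have yb: "bounded_op y" unfolding y_def by (intro bounded_op_scaleC zb)
  note yl = lin_simps[OF bounded_op_lin[OF yb]]
  have yx: "cinner u (x v) = of_real C * cinner u (y v) + of_real e * cinner u v" for u v
    using C(1) by (simp add: y_def z_def cinner_simps)
  have ys: "cinner (y u) v = cinner u (y v)" for u v
    by (simp add: y_def z_def cinner_simps xs)
  have yc: "cnorm (y v) \<le> cnorm v" for v
    using C(1) C(2)[of v] by (simp add: y_def cnorm_scaleC norm_divide field_simps)
  have "\<exists>b. pos_op b \<and> (\<forall>v. b (b v) = y (y v)) \<and>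
    (\<forall>B. bounded_op B \<and> (\<forall>v. B (y (y v)) = y (y (B v))) \<longrightarrow> (\<forall>v. B (b v) = b (B v)))"
  proof (rule sqrt_op_ex)
    show "pos_op (\<lambda>v. y (y v))"
      by (simp add: pos_op_def bounded_op_comp[OF yb yb] cinner_nonneg ys[of v "y v" for v, symmetric])
    show "Re (cinner v (y (y v))) \<le> (cnorm v)\<^sup>2" for v
      using yc[of v] power_mono[of "cnorm (y v)" "cnorm v" 2] by (simp add: ys cnorm_sq)
  qed
  then obtain b where b: "pos_op b" and bb: "\<And>v. b (b v) = y (y v)"
    and bc: "\<And>B v. bounded_op B \<Longrightarrow> (\<And>v. B (y (y v)) = y (y (B v))) \<Longrightarrow> B (b v) = b (B v)"
    by blast
  have yby: "y (b v) = b (y v)" for v by (rule bc[OF yb]) simp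
  note bl = lin_simps[OF pos_op_lin[OF b]] and bs = pos_op_sym[OF b]
  define K where "K = {v. b v + y v = 0}"
  have "closed_csubspace K"
    unfolding K_def using closed_csubspace_ker[of "{\<lambda>v. b v + y v}"] bounded_op_add[OF pos_op_bounded[OF b] yb]
    by simp
  moreover have "B v \<in> K" if B: "B \<in> commutant M" and v: "v \<in> K" for B v
  proof -
    note Bl = lin_simps[OF commutant_lin[OF B]]
    \<comment> \<open>Commutation with \<open>x\<close> passes to \<open>y\<close>, then to
      \<open>y^2\<close>, and by the clause of the square root to \<open>b\<close>; so
      \<open>B\<close> preserves \<open>K\<close>.\<close>
    have By: "B (y u) = y (B u)" for u by (simp add: y_def z_def Bl commutant_commute[OF B x(1)])
    have "B (b v + y v) = 0" using v by (simp add: K_def Bl)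
    then show ?thesis using bc[OF commutant_bounded[OF B]] by (simp add: K_def By Bl)
  qed
  ultimately obtain P where PM: "P \<in> M" and P: "orth_proj P" "\<And>v. P v \<in> K" "\<And>v. v \<in> K \<Longrightarrow> P v = v"
    using vna_proj_onto[OF M, of K] by blast
  define q where "q = (\<lambda>v. v - P v)"
  have q: "orth_proj q" "q \<in> M"
    unfolding q_def by (rule orth_proj_compl[OF P(1)], intro vna_diff vna_ident M PM)
  have perp: "cinner k (q v) = 0" if "k \<in> K" for k v
  proof -
    have "cinner (P k) (q v) = 0"
      unfolding orth_proj_sym[OF P(1)] q_def
      by (simp add: lin_diff[OF orth_proj_lin[OF P(1)]] orth_proj_idem[OF P(1)])
    then show ?thesis using P(3)[OF that] by simp
  qed
  have yK: "y k \<in> K" if "k \<in> K" for k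
  proof -
    have "y (b k + y k) = 0" using that by (simp add: K_def yl)
    then show ?thesis by (simp add: K_def yl yby)
  qed
  have low: "e * (cnorm (q v))\<^sup>2 \<le> Re (cinner (q v) (x (q v)))" for v
  proof -
    have "b (q v) = y (q v)"
    proof (rule cinner_ext)
      fix u
      \<comment> \<open>Here \<open>(b + y) (b - y) = b^2 - y^2 = 0\<close>, as \<open>b\<close> and
        \<open>y\<close> commute. The range of \<open>b - y\<close> is thus orthogonal to
        \<open>q v\<close>.\<close>
      have "b u - y u \<in> K" by (simp add: K_def bl yl yby bb)
      from perp[OF this] show "cinner u (b (q v)) = cinner u (y (q v))" by (simp add: cinner_simps bs ys)
    qed
    then have "0 \<le> Re (cinner (q v) (y (q v)))" using pos_op_Re[OF b, of "q v"] by simp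
    then show ?thesis using C(1) unfolding yx by (simp add: cinner_self)
  qed
  have up: "Re (cinner k (x k)) \<le> e * (cnorm k)\<^sup>2" if "k \<in> K" for k
  proof -
    have "y k = - b k" using that by (simp add: K_def eq_neg_iff_add_eq_0 add.commute)
    then have "Re (cinner k (y k)) \<le> 0" using pos_op_Re[OF b, of k] by (simp add: cinner_simps)
    then show ?thesis using C(1) unfolding yx by (simp add: cinner_self mult_nonneg_nonpos)
  qed
  have "op_le (\<lambda>v. scaleC (of_real e) (q v)) x"
  proof (rule op_leI)
    fix v
    have vd: "v = P v + q v" by (simp add: q_def)
    have cross: "cinner (P v) (x (q v)) = 0"
      unfolding yx using perp[OF yK[OF P(2)]] perp[OF P(2)] by (simp flip: ys)
    then have "cinner (q v) (x (P v)) = 0"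
      using cinner_commute[of "q v" "x (P v)"] by (simp add: xs)
    then have "cinner v (x v) = cinner (P v) (x (P v)) + cinner (q v) (x (q v))"
      using cross vd cinner_add_left[of "P v" "q v" "x v"] lin_add[OF pos_op_lin[OF x(2)], of "P v" "q v"]
      by (simp add: cinner_add_right)
    then have "e * (cnorm (q v))\<^sup>2 \<le> Re (cinner v (x v))"
      using low[of v] pos_op_Re[OF x(2), of "P v"] by simp
    then show "Re (cinner v (scaleC (of_real e) (q v))) \<le> Re (cinner v (x v))"
      by (simp add: cinner_simps orth_proj_cinner[OF q(1)])
  qed (simp_all add: bounded_op_scaleC orth_proj_bounded q xb pos_op_Im[OF x(2)] cinner_simps orth_proj_cinner[OF q(1)])
  moreover have "Re (cinner v (x v)) \<le> e * (cnorm v)\<^sup>2" if "q v = 0" for v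
    using up[of v] P(2)[of v] that by (simp add: q_def)
  ultimately show ?thesis using q by blast
qed

section \<open>Markov operators\<close>

lemma is_lub_in_unique: "is_lub_in M D s \<Longrightarrow> is_lub_in M D t \<Longrightarrow> s = t"
  by (intro op_le_antisym) (auto simp: is_lub_in_def)

text \<open>The forms increase to the form of \<open>L\<close>, so any upper bound dominates it.
  This translates strong limits into the order language of \<open>normal_map\<close>.\<close>

lemma is_lub_in_strong_limit:
  assumes A: "\<And>n. bounded_op (A n)" "\<And>n v. Im (cinner v (A n v)) = 0"
    "\<And>n v. Re (cinner v (A n v)) \<le> Re (cinner v (A (Suc n) v))"
    and L: "L \<in> M" "bounded_op L" "\<And>v. clim (\<lambda>n. A n v) (L v)"
  shows "is_lub_in M (range A) L"
proof -
  have re: "(\<lambda>n. Re (cinner v (A n v))) \<longlonglongrightarrow> Re (cinner v (L v))" for v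
    by (intro tendsto_Re clim_cinner L)
  have "(\<lambda>n. Im (cinner v (A n v))) \<longlonglongrightarrow> Im (cinner v (L v))" for v
    by (intro tendsto_Im clim_cinner L)
  then have im: "Im (cinner v (L v)) = 0" for v by (simp add: A LIMSEQ_const_iff)
  have le: "Re (cinner v (A n v)) \<le> Re (cinner v (L v))" for n v
    by (rule incseq_le[OF incseq_SucI re]) (rule A)
  have "op_le (A n) L" for n by (rule op_leI) (auto simp: A L im le)
  moreover have "op_le L u" if u: "u \<in> M" "\<forall>n. op_le (A n) u" for u
  proof (rule op_leI)
    show "bounded_op u" using u(2) by (auto simp: op_le_def)
    show "Im (cinner v (L v)) = Im (cinner v (u v))" for v
      using u(2)[rule_format, of 0] by (simp add: op_le_def pos_op_def cinner_simps A im)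
    show "Re (cinner v (L v)) \<le> Re (cinner v (u v))" for v
      using LIMSEQ_le_const2[OF re[of v]] op_le_Re u(2) by blast
  qed (rule L)
  ultimately show ?thesis using L by (auto simp: is_lub_in_def)
qed

locale markov =
  fixes M :: "('h::chilbert \<Rightarrow> 'h) set" and T :: "('h \<Rightarrow> 'h) \<Rightarrow> ('h \<Rightarrow> 'h)"
  assumes vna: "von_neumann_algebra M" and markov: "markov_operator M T"
begin

lemma T_closed: "A \<in> M \<Longrightarrow> T A \<in> M"
  and T_add: "A \<in> M \<Longrightarrow> B \<in> M \<Longrightarrow> T (\<lambda>x. A x + B x) = (\<lambda>x. T A x + T B x)"
  and T_scaleC: "A \<in> M \<Longrightarrow> T (\<lambda>x. scaleC c (A x)) = (\<lambda>x. scaleC c (T A x))"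
  and T_cp: "completely_positive M T"
  and T_normal: "normal_map M T"
  using markov by (simp_all add: markov_operator_def)

lemma T_zero: "T (\<lambda>x. 0) = (\<lambda>x. 0)"
  using T_scaleC[OF vna_ident[OF vna], of 0] by simp

lemma T_diff: "A \<in> M \<Longrightarrow> B \<in> M \<Longrightarrow> T (\<lambda>x. A x - B x) = (\<lambda>x. T A x - T B x)"
  using T_add[of A "\<lambda>x. scaleC (-1) (B x)"] T_scaleC[of B "-1"] vna_scaleC[OF vna, of B "-1"]
  by (simp add: scaleC_minus1)

text \<open>Complete positivity for matrices of size one.\<close>

lemma T_pos: assumes "A \<in> M" "pos_op A" shows "pos_op (T A)"
proof -
  have eq: "matrix_pos 1 (\<lambda>i j. B) \<longleftrightarrow> pos_op B" for B :: "'h \<Rightarrow> 'h"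
  proof
    assume *: "matrix_pos 1 (\<lambda>i j. B)"
    then have "Im (cinner v (B v)) = 0 \<and> 0 \<le> Re (cinner v (B v))" for v
      unfolding matrix_pos_def Let_def by (auto dest!: spec[of _ "\<lambda>_. v"])
    then show "pos_op B" using * by (auto simp: matrix_pos_def pos_op_def)
  qed (simp add: matrix_pos_def pos_op_def Let_def)
  have "matrix_pos 1 (\<lambda>i j. T A)"
    by (rule T_cp[unfolded completely_positive_def, rule_format, of 1 "\<lambda>i j. A"]) (use assms eq in blast)
  then show ?thesis unfolding eq .
qed

lemma Tn_closed: "A \<in> M \<Longrightarrow> (T ^^ n) A \<in> M"
  by (induction n) (auto simp: T_closed)

lemma Tn_pos: "A \<in> M \<Longrightarrow> pos_op A \<Longrightarrow> pos_op ((T ^^ n) A)"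
  by (induction n) (auto simp: T_pos Tn_closed)

lemma Tn_scaleC: "A \<in> M \<Longrightarrow> (T ^^ n) (\<lambda>x. scaleC c (A x)) = (\<lambda>x. scaleC c ((T ^^ n) A x))"
  by (induction n) (auto simp: T_scaleC Tn_closed)

lemma Tn_diff: "A \<in> M \<Longrightarrow> B \<in> M \<Longrightarrow> (T ^^ n) (\<lambda>x. A x - B x) = (\<lambda>x. (T ^^ n) A x - (T ^^ n) B x)"
  by (induction n) (auto simp: T_diff Tn_closed)

section \<open>Partial sums and potentials\<close>

definition psum :: "('h \<Rightarrow> 'h) \<Rightarrow> nat \<Rightarrow> 'h \<Rightarrow> 'h" where
  "psum A N = (\<lambda>v. \<Sum>n<N. (T ^^ n) A v)"

lemma psum_0: "psum A 0 = (\<lambda>v. 0)"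
  and psum_Suc: "psum A (Suc N) = (\<lambda>v. psum A N v + (T ^^ N) A v)"
  by (simp_all add: psum_def)

lemma psum_closed: "A \<in> M \<Longrightarrow> psum A N \<in> M"
  by (induction N) (auto simp: psum_0 psum_Suc intro: vna_zero[OF vna] vna_add[OF vna] Tn_closed)

lemma psum_pos: "A \<in> M \<Longrightarrow> pos_op A \<Longrightarrow> pos_op (psum A N)"
  by (induction N) (auto simp: psum_0 psum_Suc intro: pos_op_zero pos_op_add Tn_pos)

text \<open>\<open>T\<close> moves each term on by one, so the index grows and the initial term
  \<open>A\<close> is lost.\<close>

lemma T_psum: "A \<in> M \<Longrightarrow> T (psum A N) = (\<lambda>v. psum A (Suc N) v - A v)"
proof (induction N)
  case (Suc N)
  have "T (psum A (Suc N)) = (\<lambda>v. T (psum A N) v + (T ^^ Suc N) A v)"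
    using T_add[OF psum_closed[OF Suc.prems, of N] Tn_closed[OF Suc.prems, of N]] by (simp add: psum_Suc)
  then show ?case using Suc by (simp add: psum_Suc[of A "Suc N"] fun_eq_iff algebra_simps)
qed (simp add: psum_0 psum_Suc T_zero)

lemma T_summable_iff:
  "T_summable M T A \<longleftrightarrow> A \<in> M \<and> pos_op A \<and> (\<exists>y\<in>M. pos_op y \<and> (\<forall>v. clim (\<lambda>N. psum A N v) (y v)))"
  by (simp add: T_summable_def clim_def psum_def)

lemma T_summable_if_bounded:
  assumes A: "A \<in> M" "pos_op A" and c: "c \<ge> 0" "\<And>N v. Re (cinner v (psum A N v)) \<le> c * (cnorm v)\<^sup>2"
  shows "T_summable M T A"
proof -
  have "\<exists>y. pos_op y \<and> (\<forall>v. clim (\<lambda>N. psum A N v) (y v))"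
    by (rule monotone_strong_limit[OF psum_pos[OF A] _ c]) (simp add: psum_Suc Tn_pos[OF A])
  then obtain y where y: "pos_op y" "\<And>v. clim (\<lambda>N. psum A N v) (y v)" by blast
  have "y \<in> M" by (rule vna_strong_limit[OF vna psum_closed[OF A(1)] pos_op_bounded[OF y(1)] y(2)])
  then show ?thesis using A y unfolding T_summable_iff by blast
qed

text \<open>The sum \<open>y\<close> is a potential: normality turns \<open>y = sup \<Sum>\<^sub>n T\<^sup>n A\<close> into \<open>T y = y - A\<close>.\<close>
lemma potential_ex:
  assumes "T_summable M T A"
  shows "\<exists>y\<in>M. pos_op y \<and> T y = (\<lambda>v. y v - A v)"
proof -
  obtain y where A: "A \<in> M" "pos_op A" and y: "y \<in> M" "pos_op y" "\<And>v. clim (\<lambda>N. psum A N v) (y v)"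
    using assms unfolding T_summable_iff by blast
  note sp = psum_pos[OF A]
  have inc: "Re (cinner v (psum A N v)) \<le> Re (cinner v (psum A (Suc N) v))" for N v
    using pos_op_Re[OF Tn_pos[OF A]] by (simp add: psum_Suc cinner_simps)
  have dir: "op_le (psum A m) (psum A n)" if "m \<le> n" for m n
  proof (rule op_leI)
    have "incseq (\<lambda>N. Re (cinner v (psum A N v)))" for v by (rule incseq_SucI, rule inc)
    then show "Re (cinner v (psum A m v)) \<le> Re (cinner v (psum A n v))" for v using that by (rule incseqD)
  qed (auto simp: pos_op_bounded[OF sp] pos_op_Im[OF sp])
  have "is_lub_in M (range (psum A)) y"
    by (rule is_lub_in_strong_limit) (auto intro: pos_op_bounded[OF sp] pos_op_Im[OF sp] inc y pos_op_bounded)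
  moreover have "\<exists>z\<in>range (psum A). op_le a z \<and> op_le b z" if "a \<in> range (psum A)" "b \<in> range (psum A)" for a b
  proof -
    from that obtain m n where "a = psum A m" "b = psum A n" by blast
    then show ?thesis using dir[of m "max m n"] dir[of n "max m n"] by auto
  qed
  moreover have "range (psum A) \<subseteq> M" "\<forall>d\<in>range (psum A). pos_op d"
    using psum_closed[OF A(1)] sp by auto
  ultimately have 1: "is_lub_in M (T ` range (psum A)) (T y)"
    by (intro T_normal[unfolded normal_map_def, rule_format] conjI ballI) auto
  \<comment> \<open>The images of the partial sums have \<open>T y\<close> as supremum by normality,
    and \<open>y - A\<close> by strong convergence; uniqueness of suprema identifies the
    two.\<close>
  have "is_lub_in M (range (\<lambda>N v. psum A (Suc N) v - A v)) (\<lambda>v. y v - A v)"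
  proof (rule is_lub_in_strong_limit)
    show "clim (\<lambda>n. psum A (Suc n) v - A v) (y v - A v)" for v
      by (intro clim_diff clim_const clim_Suc[OF y(3)])
    show "(\<lambda>v. y v - A v) \<in> M" by (intro vna_diff vna y A)
  qed (use inc in \<open>auto simp: cinner_simps pos_op_Im[OF sp] pos_op_Im[OF A(2)]
      intro!: bounded_op_diff pos_op_bounded[OF sp] pos_op_bounded[OF A(2)] pos_op_bounded[OF y(2)]\<close>)
  moreover have "T ` range (psum A) = range (\<lambda>N v. psum A (Suc N) v - A v)"
    by (simp add: image_image T_psum[OF A(1)])
  ultimately have "T y = (\<lambda>v. y v - A v)" using 1 is_lub_in_unique by simp
  then show ?thesis using y by blast
qed

lemma summable_if_dominated:
  assumes a: "a \<in> M" "pos_op a" and q: "q \<in> M" "pos_op q"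
    and e: "e > 0" and le: "op_le (\<lambda>v. scaleC (of_real e) (q v)) (\<lambda>v. a v - T a v)"
  shows "T_summable M T q"
proof -
  obtain c where c: "c > 0" "\<And>v. Re (cinner v (a v)) \<le> c * (cnorm v)\<^sup>2"
    using bounded_op_form_bound[OF pos_op_bounded[OF a(2)]] by blast
  \<comment> \<open>Positivity of the \<open>n\<close>-th image of \<open>d\<close> bounds
    \<open>e\<close> times the \<open>n\<close>-th image of \<open>q\<close> by a telescoping
    difference. The sum is at most \<open>c\<close>, whence the bound \<open>c / e\<close>.\<close>
  define d where "d = (\<lambda>v. (a v - T a v) - scaleC (of_real e) (q v))"
  have xM: "(\<lambda>v. a v - T a v) \<in> M" and eM: "(\<lambda>v. scaleC (of_real e) (q v)) \<in> M"
    by (intro vna_diff vna_scaleC vna a q T_closed)+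
  have dM: "d \<in> M" unfolding d_def by (rule vna_diff[OF vna xM eM])
  have dp: "pos_op d" using le by (simp add: op_le_def d_def)
  have "(T ^^ n) d = (\<lambda>v. ((T ^^ n) a v - (T ^^ Suc n) a v) - scaleC (of_real e) ((T ^^ n) q v))" for n
    unfolding d_def
    by (simp add: Tn_diff[OF xM eM] Tn_scaleC[OF q(1)] Tn_diff[OF a(1) T_closed[OF a(1)]] funpow_swap1)
  then have tn: "e * Re (cinner v ((T ^^ n) q v))
      \<le> Re (cinner v ((T ^^ n) a v)) - Re (cinner v ((T ^^ Suc n) a v))" for n v
    using pos_op_Re[OF Tn_pos[OF dM dp], of v n] by (simp add: cinner_simps)
  have "Re (cinner v (psum q N v)) \<le> (c / e) * (cnorm v)\<^sup>2" for N v
  proof -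
    have "e * Re (cinner v (psum q N v)) = (\<Sum>n<N. e * Re (cinner v ((T ^^ n) q v)))"
      by (simp add: psum_def cinner_sum_right sum_distrib_left)
    also have "\<dots> \<le> (\<Sum>n<N. Re (cinner v ((T ^^ n) a v)) - Re (cinner v ((T ^^ Suc n) a v)))"
      by (intro sum_mono tn)
    also have "\<dots> = Re (cinner v (a v)) - Re (cinner v ((T ^^ N) a v))"
      by (subst sum_lessThan_telescope') simp
    also have "\<dots> \<le> c * (cnorm v)\<^sup>2" using c(2)[of v] pos_op_Re[OF Tn_pos[OF a], of v N] by linarith
    finally show ?thesis using e by (simp add: field_simps)
  qed
  then show ?thesis using c(1) e by (intro T_summable_if_bounded[OF q, of "c / e"]) auto
qed

text \<open>Existence and uniqueness of the supremum give the definite description its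
  meaning.\<close>

lemma max_transient_proj_sup: "is_proj_sup M {q. transient_proj M T q} (max_transient_proj M T)"
proof -
  obtain s where s: "is_proj_sup M {q. transient_proj M T q} s"
    using is_proj_sup_ex[OF vna, of "{q. transient_proj M T q}"] by (auto simp: transient_proj_def)
  show ?thesis unfolding max_transient_proj_def
    by (rule theI[where P = "is_proj_sup M {q. transient_proj M T q}", OF s]) (rule is_proj_sup_unique[OF _ s])
qed

lemma transient_if_summable:
  assumes "orth_proj q" "T_summable M T q"
  shows "transient_proj M T q"
proof -
  have "q \<in> M" using assms by (simp add: T_summable_def)
  moreover have "op_le q q" by (rule op_le_refl[OF orth_proj_bounded[OF assms(1)]])
  ultimately have "is_proj_sup M {q} q" using assms by (auto simp: is_proj_sup_def)
  then show ?thesis unfolding transient_proj_def using assms \<open>q \<in> M\<close> \<open>op_le q q\<close> by blast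
qed

lemma recurrent_imp_potential_invariant:
  assumes p: "orth_proj p" and rec: "op_le (max_transient_proj M T) (\<lambda>v. v - p v)"
    and a: "a \<in> M" "pos_op a" "op_le (T a) a"
  shows "p (T a (p v)) = p (a (p v))"
proof -
  define x where "x = (\<lambda>v. a v - T a v)"
  have x: "x \<in> M" "pos_op x"
    unfolding x_def using a by (auto simp: op_le_def intro: vna_diff vna T_closed)
  note sup = max_transient_proj_sup
  define w where "w = p v"
  have pw: "w - p w = 0" by (simp add: w_def orth_proj_idem[OF p])
  have "Re (cinner w (x w)) \<le> e * (cnorm w)\<^sup>2" if e: "e > 0" for e
  proof -
    obtain q where q: "q \<in> M" "orth_proj q" "op_le (\<lambda>v. scaleC (of_real e) (q v)) x"
      and qx: "\<And>v. q v = 0 \<Longrightarrow> Re (cinner v (x v)) \<le> e * (cnorm v)\<^sup>2"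
      using spectral_projection_ex[OF vna x e] by blast
    have "T_summable M T q"
      using summable_if_dominated[OF a(1,2) q(1) orth_proj_pos[OF q(2)] e] q(3) by (simp add: x_def)
    then have "op_le q (max_transient_proj M T)"
      using sup transient_if_summable[OF q(2)] by (auto simp: is_proj_sup_def)
    moreover have P: "orth_proj (max_transient_proj M T)" using sup by (simp add: is_proj_sup_def)
    moreover have "max_transient_proj M T w = 0"
      using rec pw orth_proj_le_iff[OF P orth_proj_compl[OF p]] by blast
    ultimately have "q w = 0" using orth_proj_le_iff[OF q(2) P] by blast
    then show ?thesis by (rule qx)
  qed
  \<comment> \<open>The factor \<open>(cnorm w)^2\<close> is absorbed into \<open>e\<close>; the
    shape \<open>0 + e\<close> fits \<open>field_le_epsilon\<close>.\<close>
  then have "Re (cinner w (x w)) \<le> 0 + e" if "e > 0" for e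
  proof (cases "w = 0")
    case False
    then have n: "(cnorm w)\<^sup>2 > 0" by simp
    show ?thesis using \<open>\<And>e. e > 0 \<Longrightarrow> Re (cinner w (x w)) \<le> e * (cnorm w)\<^sup>2\<close>[of "e / (cnorm w)\<^sup>2"] that n by simp
  qed (use that in simp)
  then have "Re (cinner w (x w)) \<le> 0" by (rule field_le_epsilon)
  then have "Re (cinner w (x w)) = 0" using pos_op_Re[OF x(2), of w] by simp
  \<comment> \<open>A vanishing form at \<open>w\<close> yields even \<open>x w = 0\<close>, that is
    \<open>a w = T a w\<close> before applying \<open>p\<close>.\<close>
  then have "(cmod (cinner u (x w)))\<^sup>2 \<le> 0" for u
    using pos_op_Cauchy_Schwarz[OF x(2), of u w] by simp
  then have "x w = 0" using cinner_ext[of "x w" 0] by simp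
  then show ?thesis by (simp add: x_def w_def)
qed

lemma potential_invariant_imp_recurrent:
  assumes p: "orth_proj p" "p \<in> M"
    and inv: "\<And>a v. a \<in> M \<Longrightarrow> pos_op a \<Longrightarrow> op_le (T a) a \<Longrightarrow> p (T a (p v)) = p (a (p v))"
  shows "op_le (max_transient_proj M T) (\<lambda>v. v - p v)"
proof -
  let ?r = "\<lambda>v. v - p v"
  have r: "orth_proj ?r" "?r \<in> M" by (rule orth_proj_compl[OF p(1)], intro vna_diff vna_ident vna p)
  have sm: "op_le q ?r" if q: "orth_proj q" "T_summable M T q" for q
  proof -
    obtain y where y: "y \<in> M" "pos_op y" and Ty: "T y = (\<lambda>v. y v - q v)"
      using potential_ex[OF q(2)] by blast
    have "op_le (T y) y"
      unfolding op_le_def using y orth_proj_pos[OF q(1)] vna_bounded[OF vna T_closed[OF y(1)]]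
      by (simp add: Ty pos_op_bounded)
    then have pqp: "p (q (p v)) = 0" for v
      using inv[OF y, of v] by (simp add: Ty lin_diff[OF orth_proj_lin[OF p(1)]])
    \<comment> \<open>For \<open>v\<close> fixed by \<open>p\<close>, the squared norm of
      \<open>q v\<close> is the form of \<open>p q p\<close> at \<open>v\<close>.\<close>
    have "q v = 0" if "v - p v = 0" for v
    proof -
      have pv: "p v = v" using that by simp
      have "cinner v (q v) = cinner v (p (q (p v)))"
        using orth_proj_sym[OF p(1), of v "q v"] pv by simp
      then have "cinner v (q v) = 0" by (simp add: pqp)
      then show ?thesis by (simp add: orth_proj_cinner[OF q(1)])
    qed
    then show ?thesis using orth_proj_le_iff[OF q(1) r(1)] by blast
  qed
  have "op_le q ?r" if "transient_proj M T q" for q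
  proof -
    from that obtain S s where S: "\<forall>p\<in>S. orth_proj p \<and> T_summable M T p" "is_proj_sup M S s" "op_le q s"
      and q: "orth_proj q" by (auto simp: transient_proj_def)
    have s: "orth_proj s" using S(2) by (simp add: is_proj_sup_def)
    have "op_le s ?r" using S(1) sm r by (intro is_proj_sup_least[OF S(2)]) auto
    then show ?thesis
      using S(3) orth_proj_le_iff[OF q s] orth_proj_le_iff[OF s r(1)] orth_proj_le_iff[OF q r(1)] by simp
  qed
  then show ?thesis using r by (intro is_proj_sup_least[OF max_transient_proj_sup]) auto
qed

end

theorem theorem5p5:
  fixes M :: "('h::chilbert \<Rightarrow> 'h) set"
    and T :: "('h \<Rightarrow> 'h) \<Rightarrow> ('h \<Rightarrow> 'h)"
    and p :: "'h \<Rightarrow> 'h"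
  assumes "von_neumann_algebra M"
    and "markov_operator M T"
    and "p \<in> M" and "orth_proj p"
  shows "op_le p (\<lambda>x. x - max_transient_proj M T x) \<longleftrightarrow>
         (\<forall>a\<in>M. pos_op a \<and> op_le (T a) a \<longrightarrow> p \<circ> T a \<circ> p = p \<circ> a \<circ> p)"
proof -
  interpret markov M T using assms by unfold_locales
  have P: "orth_proj (max_transient_proj M T)"
    using max_transient_proj_sup by (simp add: is_proj_sup_def)
  \<comment> \<open>Both inequalities assert positivity of the same operator
    \<open>1 - p_Tr - p\<close>.\<close>
  have "(\<lambda>x. x - max_transient_proj M T x - p x) = (\<lambda>x. x - p x - max_transient_proj M T x)"
    by (simp add: algebra_simps)
  then have "op_le p (\<lambda>x. x - max_transient_proj M T x) \<longleftrightarrow> op_le (max_transient_proj M T) (\<lambda>x. x - p x)"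
    unfolding op_le_def
    using orth_proj_bounded[OF P] orth_proj_bounded[OF orth_proj_compl[OF P]]
      orth_proj_bounded[OF assms(4)] orth_proj_bounded[OF orth_proj_compl[OF assms(4)]] by simp
  then show ?thesis
    using recurrent_imp_potential_invariant[OF assms(4)] potential_invariant_imp_recurrent[OF assms(4,3)]
    by (auto simp: fun_eq_iff)
qed

end
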